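(* Let $f:X\to X$ be a continuous map with the gluing orbit property on a compact metric space $X$, let $d\ge 1$ and let $\varphi:X\to\mathbb R^d$ be a continuous observable. Assume that $X_{\varphi,f}\neq\emptyset$. Then $X_{\varphi,f}$ carries full topological pressure and full metric mean dimension.
   Context: Let $d(\cdot,\cdot)$ also denote the metric of $X$. $X_{\varphi,f}$ is the set of $x\in X$ such that $\lim_{n\to\infty}\frac1n\sum_{j=0}^{n-1}\varphi(f^j(x))$ does not exist. Gluing orbit property: for every $\varepsilon>0$ there is an integer $m=m(\varepsilon)\ge1$ such that for any points $x_1,\dots,x_k\in X$ and positive integers $n_1,\dots,n_k$ there are integers $0\le p_1,\dots,p_{k-1}\le m(\varepsilon)$ and a point $y\in X$ such that $d(f^j(y),f^j(x_1))\le\varepsilon$ for $0\le j\le n_1$ and $d(f^{\,j+n_1+p_1+\cdots+n_{i-1}+p_{i-1}}(y),f^j(x_i))\le\varepsilon$ for every $2\le i\le k$ and $0\le j\le n_i$. Pressure and metric mean dimension. Put $d_n(x,y)=\max_{0\le j\le n-1} d(f^j(x),f^j(y))$, $B_n(x,\varepsilon)=\{y: d_n(x,y)<\varepsilon\}$, $S_n\psi=\sum_{j=0}^{n-1}\psi\circ f^j$. A set $E$ is $(n,\varepsilon)$-separated if $d_n(x,y)>\varepsilon$ for distinct $x,y\in E$; $s(n,\varepsilon)$ is the maximal cardinality of an $(n,\varepsilon)$-separated set. For $\psi\in C^0(X,\mathbb R)$, $P_{top}(f,\psi)=\lim_{\varepsilon\to0}\limsup_{n\to\infty}\frac1n\log\sup_E\sum_{x\in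 E}e^{S_n\psi(x)}$, the supremum being over $(n,\varepsilon)$-separated sets $E$. Further, $\overline{\mathrm{mdim}}(f)=\limsup_{\varepsilon\to0}\frac{\limsup_{n}\frac1n\log s(n,\varepsilon)}{-\log\varepsilon}$ and $\underline{\mathrm{mdim}}(f)=\liminf_{\varepsilon\to0}\frac{\liminf_{n}\frac1n\log s(n,\varepsilon)}{-\log\varepsilon}$. Relative versions. For an $f$-invariant Borel set $Z\subset X$ and $s\in\mathbb R$, let $M(Z,\psi,s,\varepsilon,N)=\inf_\Gamma\sum_{B_{n_i}(x_i,\varepsilon)\in\Gamma}\exp\big(-s\,n_i+\sup_{x\in B_{n_i}(x_i,\varepsilon)}S_{n_i}\psi(x)\big)$, the infimum being over countable collections $\Gamma=\{B_{n_i}(x_i,\varepsilon)\}_i$ covering $Z$ with all $n_i\ge N$; let $m(Z,\psi,s,\varepsilon)=\lim_{N\to\infty}M(Z,\psi,s,\varepsilon,N)$, $P_Z(f,\psi,\varepsilon)=\inf\{s: m(Z,\psi,s,\varepsilon)=0\}$, $P_Z(f,\psi)=\lim_{\varepsilon\to0}P_Z(f,\psi,\varepsilon)$, $h_Z(f,\varepsilon)=P_Z(f,0,\varepsilon)$, $\overline{\mathrm{mdim}}_Z(f)=\limsup_{\varepsilon\to0}\frac{h_Z(f,\varepsilon)}{-\log\varepsilon}$ and $\underline{\mathrm{mdim}}_Z(f)=\liminf_{\varepsilon\to0}\frac{h_Z(f,\varepsilon)}{-\log\varepsilon}$. $Z$ carries full topological pressure if $P_Z(f,\psi)=P_{top}(f,\psi)$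 for every $\psi\in C^0(X,\mathbb R)$ (values may be infinite), and full metric mean dimension if $\underline{\mathrm{mdim}}_Z(f)=\underline{\mathrm{mdim}}(f)$ and $\overline{\mathrm{mdim}}_Z(f)=\overline{\mathrm{mdim}}(f)$. *)

theory Defs
  imports "HOL-Analysis.Analysis"
begin

text \<open>
  The compact metric space \<open>X\<close> is a type of class \<open>metric_space\<close> with \<^prop>\<open>compact UNIV\<close>.
  The real-valued maxima and suprema below have their usual meaning for compact \<open>X\<close>, \<open>\<epsilon> > 0\<close>, \<open>n \<ge> 1\<close>
  and continuous \<open>f\<close>, \<open>\<psi>\<close>: separated sets are then finite, of bounded cardinality, and Birkhoff
  sums are bounded. The values at \<open>n = 0\<close> are junk, but only limits as \<open>n \<rightarrow> \<infinity>\<close>, or as \<open>N \<rightarrow> \<infinity>\<close>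
  over covers with all \<open>n \<ge> N\<close>, are ever taken.
\<close>

definition birkhoff_sum :: "('a \<Rightarrow> 'a) \<Rightarrow> ('a \<Rightarrow> 'b::comm_monoid_add) \<Rightarrow> nat \<Rightarrow> 'a \<Rightarrow> 'b" where
  "birkhoff_sum f \<psi> n x = (\<Sum>j<n. \<psi> ((f ^^ j) x))"

definition irregular_set :: "('a \<Rightarrow> 'a) \<Rightarrow> ('a \<Rightarrow> 'b::real_normed_vector) \<Rightarrow> 'a set" where
  "irregular_set f \<phi> = {x. \<not> convergent (\<lambda>n. (1 / real n) *\<^sub>R birkhoff_sum f \<phi> n x)}"

text \<open>
  For \<open>i = 1\<close> the sum in the time shift is empty, so \<open>y\<close> itself follows the orbit of \<open>x 1\<close>.
\<close>

definition gluing_orbit_property :: "('a::metric_space \<Rightarrow> 'a) \<Rightarrow> bool" where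
  "gluing_orbit_property f \<longleftrightarrow>
    (\<forall>\<epsilon>>0. \<exists>m\<ge>1. \<forall>k\<ge>1. \<forall>(x :: nat \<Rightarrow> 'a) (n :: nat \<Rightarrow> nat). (\<forall>i\<in>{1..k}. n i \<ge> 1) \<longrightarrow>
      (\<exists>(p :: nat \<Rightarrow> nat) y. (\<forall>i\<in>{1..<k}. p i \<le> m) \<and>
        (\<forall>i\<in>{1..k}. \<forall>j\<le>n i.
          dist ((f ^^ (j + (\<Sum>l\<in>{1..<i}. n l + p l))) y) ((f ^^ j) (x i)) \<le> \<epsilon>)))"

definition bowen_dist :: "('a::metric_space \<Rightarrow> 'a) \<Rightarrow> nat \<Rightarrow> 'a \<Rightarrow> 'a \<Rightarrow> real" where
  "bowen_dist f n x y = (MAX j\<in>{..<n}. dist ((f ^^ j) x) ((f ^^ j) y))"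

definition bowen_ball :: "('a::metric_space \<Rightarrow> 'a) \<Rightarrow> nat \<Rightarrow> 'a \<Rightarrow> real \<Rightarrow> 'a set" where
  "bowen_ball f n x \<epsilon> = {y. bowen_dist f n x y < \<epsilon>}"

definition separated :: "('a::metric_space \<Rightarrow> 'a) \<Rightarrow> nat \<Rightarrow> real \<Rightarrow> 'a set \<Rightarrow> bool" where
  "separated f n \<epsilon> E \<longleftrightarrow> (\<forall>x\<in>E. \<forall>y\<in>E. x \<noteq> y \<longrightarrow> bowen_dist f n x y > \<epsilon>)"

definition max_separated :: "('a::metric_space \<Rightarrow> 'a) \<Rightarrow> nat \<Rightarrow> real \<Rightarrow> nat" where
  "max_separated f n \<epsilon> = Max (card ` {E. separated f n \<epsilon> E})"

definition top_pressure :: "('a::metric_space \<Rightarrow> 'a) \<Rightarrow> ('a \<Rightarrow> real) \<Rightarrow> ereal" where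
  "top_pressure f \<psi> = Lim (at_right 0) (\<lambda>\<epsilon>. limsup (\<lambda>n. ereal (1 / real n *
     ln (SUP E\<in>{E. separated f n \<epsilon> E}. \<Sum>x\<in>E. exp (birkhoff_sum f \<psi> n x)))))"

definition upper_mdim :: "('a::metric_space \<Rightarrow> 'a) \<Rightarrow> ereal" where
  "upper_mdim f = Limsup (at_right 0) (\<lambda>\<epsilon>.
     limsup (\<lambda>n. ereal (1 / real n * ln (real (max_separated f n \<epsilon>)))) / ereal (- ln \<epsilon>))"

definition lower_mdim :: "('a::metric_space \<Rightarrow> 'a) \<Rightarrow> ereal" where
  "lower_mdim f = Liminf (at_right 0) (\<lambda>\<epsilon>.
     liminf (\<lambda>n. ereal (1 / real n * ln (real (max_separated f n \<epsilon>)))) / ereal (- ln \<epsilon>))"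

text \<open>
  A countable collection of Bowen balls is encoded by the countable set of its pairs
  (centre, length); the empty collection is allowed.
\<close>

definition ball_covers :: "('a::metric_space \<Rightarrow> 'a) \<Rightarrow> 'a set \<Rightarrow> real \<Rightarrow> nat \<Rightarrow> ('a \<times> nat) set set" where
  "ball_covers f Z \<epsilon> N = {\<Gamma>. countable \<Gamma> \<and> (\<forall>(x, n)\<in>\<Gamma>. n \<ge> N) \<and>
     Z \<subseteq> (\<Union>(x, n)\<in>\<Gamma>. bowen_ball f n x \<epsilon>)}"

definition cover_sum_inf ::
    "('a::metric_space \<Rightarrow> 'a) \<Rightarrow> 'a set \<Rightarrow> ('a \<Rightarrow> real) \<Rightarrow> real \<Rightarrow> real \<Rightarrow> nat \<Rightarrow> ennreal" where
  "cover_sum_inf f Z \<psi> s \<epsilon> N = (INF \<Gamma>\<in>ball_covers f Z \<epsilon> N. \<Sum>\<^sub>\<infinity>(x, n)\<in>\<Gamma>.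
     ennreal (exp (- s * real n + (SUP y\<in>bowen_ball f n x \<epsilon>. birkhoff_sum f \<psi> n y))))"

definition cover_measure ::
    "('a::metric_space \<Rightarrow> 'a) \<Rightarrow> 'a set \<Rightarrow> ('a \<Rightarrow> real) \<Rightarrow> real \<Rightarrow> real \<Rightarrow> ennreal" where
  "cover_measure f Z \<psi> s \<epsilon> = lim (\<lambda>N. cover_sum_inf f Z \<psi> s \<epsilon> N)"

definition pressure_at ::
    "('a::metric_space \<Rightarrow> 'a) \<Rightarrow> 'a set \<Rightarrow> ('a \<Rightarrow> real) \<Rightarrow> real \<Rightarrow> ereal" where
  "pressure_at f Z \<psi> \<epsilon> = Inf (ereal ` {s. cover_measure f Z \<psi> s \<epsilon> = 0})"

definition rel_pressure :: "('a::metric_space \<Rightarrow> 'a) \<Rightarrow> 'a set \<Rightarrow> ('a \<Rightarrow> real) \<Rightarrow> ereal" where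
  "rel_pressure f Z \<psi> = Lim (at_right 0) (\<lambda>\<epsilon>. pressure_at f Z \<psi> \<epsilon>)"

definition entropy_at :: "('a::metric_space \<Rightarrow> 'a) \<Rightarrow> 'a set \<Rightarrow> real \<Rightarrow> ereal" where
  "entropy_at f Z \<epsilon> = pressure_at f Z (\<lambda>x. 0) \<epsilon>"

definition upper_rel_mdim :: "('a::metric_space \<Rightarrow> 'a) \<Rightarrow> 'a set \<Rightarrow> ereal" where
  "upper_rel_mdim f Z = Limsup (at_right 0) (\<lambda>\<epsilon>. entropy_at f Z \<epsilon> / ereal (- ln \<epsilon>))"

definition lower_rel_mdim :: "('a::metric_space \<Rightarrow> 'a) \<Rightarrow> 'a set \<Rightarrow> ereal" where
  "lower_rel_mdim f Z = Liminf (at_right 0) (\<lambda>\<epsilon>. entropy_at f Z \<epsilon> / ereal (- ln \<epsilon>))"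

definition carries_full_pressure :: "('a::metric_space \<Rightarrow> 'a) \<Rightarrow> 'a set \<Rightarrow> bool" where
  "carries_full_pressure f Z \<longleftrightarrow>
    (\<forall>\<psi>. continuous_on UNIV \<psi> \<longrightarrow> rel_pressure f Z \<psi> = top_pressure f \<psi>)"

definition carries_full_mdim :: "('a::metric_space \<Rightarrow> 'a) \<Rightarrow> 'a set \<Rightarrow> bool" where
  "carries_full_mdim f Z \<longleftrightarrow>
    lower_rel_mdim f Z = lower_mdim f \<and> upper_rel_mdim f Z = upper_mdim f"

end

theory Submission
  imports Defs "HOL-Probability.Infinite_Product_Measure"
begin

text \<open>
  Write \<open>Z\<close> for the irregular set. That \<open>Z\<close> carries at most the full pressure and the full metric mean
  dimension holds for every set: a maximal \<open>(n, \<epsilon>/2)\<close>-separated set gives a cover by Bowen balls of the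
  single length \<open>n\<close> (\<open>pressure_at_leI\<close>). The content is the lower bound.

  Let \<open>x\<^sub>0\<close> be an irregular point and \<open>E\<close> a large \<open>(n, 4\<epsilon>)\<close>-separated set. For a sequence
  \<open>u\<^sub>0, u\<^sub>1, \<dots>\<close> in \<open>E\<close>, glue the orbit segments of length \<open>n\<close> of \<open>u\<^sub>0, u\<^sub>1, \<dots>\<close>, and between \<open>u\<^sub>i\<close> and
  \<open>u\<^sub>i\<^sub>+\<^sub>1\<close> insert the \<open>i\<close>-th piece, of length \<open>L \<approx> \<delta>n\<close>, of the orbit of \<open>x\<^sub>0\<close>, cut into consecutive
  pieces. By the pigeonhole principle the \<open>\<phi>\<close>-averages over the segments from \<open>E\<close> may be assumed almost
  equal to one vector \<open>a\<close>, at the price of a constant factor in the size of \<open>E\<close>. Then the Birkhoff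
  averages of the glued point are, up to a small error, convex combinations with fixed weights of \<open>a\<close>
  and of the averages of \<open>x\<^sub>0\<close>, so they inherit the divergence of the latter
  (\<open>interleaved_orbit_average\<close>). The shadowing error must be small against \<open>\<delta>\<close> times the oscillation of
  the averages of \<open>x\<^sub>0\<close>; therefore \<open>\<delta>\<close> is fixed first and \<open>\<epsilon>\<close> is taken small in terms of \<open>\<delta>\<close>.

  All glued points lie in \<open>Z\<close>, and there are enough of them. The gaps that gluing produces depend on
  the whole sequence, but a Bowen ball whose length covers \<open>k\<close> periods determines the first \<open>k\<close> words
  once the gaps are known. It thus meets at most as many cylinders of length \<open>k\<close> as there are gap
  vectors, \<open>(g + 1)^k\<close>, and \<open>ln (g + 1)\<close> is negligible against \<open>n\<close>. Weighing words by the product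
  measure with weights proportional to \<open>exp (S\<^sub>n \<psi>)\<close>, a cover of \<open>Z\<close> of small cost would give a cover of
  the full sequence space by cylinders of total measure below \<open>1\<close>
  (\<open>pressure_at_ge_of_concatenations\<close>).

  The outcome (\<open>pressure_at_irregular_set_ge\<close>) is that the separated growth rate at scale \<open>4\<epsilon>\<close> is at most
  \<open>1 + \<delta>\<close> times the pressure of \<open>Z\<close> at scale \<open>\<epsilon>\<close>, up to errors that vanish with \<open>\<epsilon>\<close> and \<open>\<delta>\<close>. Letting
  \<open>\<epsilon> \<rightarrow> 0\<close> and then \<open>\<delta> \<rightarrow> 0\<close> gives the pressure. For \<open>\<psi> = 0\<close> the only error is the factor \<open>1 + \<delta>\<close>, and the
  change of scale is invisible after division by \<open>- ln \<epsilon>\<close>, which gives the metric mean dimension.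
\<close>

section \<open>Birkhoff sums and Bowen balls\<close>

lemma birkhoff_sum_add:
  "birkhoff_sum f \<psi> (a + b) x = birkhoff_sum f \<psi> a x + birkhoff_sum f \<psi> b ((f ^^ a) x)"
proof -
  have "{..<a + b} = {..<a} \<union> (+) a ` {..<b}"
    by (simp add: lessThan_atLeast0 ivl_disj_un_two(3) add.commute[of b])
  moreover have "(\<Sum>j\<in>(+) a ` {..<b}. \<psi> ((f ^^ j) x)) = (\<Sum>j<b. \<psi> ((f ^^ j) ((f ^^ a) x)))"
    by (subst sum.reindex) (auto simp: inj_on_def add.commute[of a] funpow_add)
  ultimately show ?thesis
    by (simp add: birkhoff_sum_def) (subst sum.union_disjoint, auto)
qed

lemma norm_birkhoff_sum_le:
  fixes \<psi> :: "'a \<Rightarrow> 'b::real_normed_vector"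
  assumes "\<And>x. norm (\<psi> x) \<le> B"
  shows "norm (birkhoff_sum f \<psi> n x) \<le> real n * B"
  unfolding birkhoff_sum_def
  using norm_sum[of "\<lambda>j. \<psi> ((f ^^ j) x)" "{..<n}"] sum_bounded_above[of "{..<n}" "\<lambda>j. norm (\<psi> ((f ^^ j) x))" B] assms
  by (fastforce intro: order_trans)

lemma norm_birkhoff_sum_diff_le:
  fixes \<psi> :: "'a::metric_space \<Rightarrow> 'b::real_normed_vector"
  assumes "\<And>x y. dist x y \<le> \<epsilon> \<Longrightarrow> norm (\<psi> x - \<psi> y) \<le> v"
    and "\<And>j. j < n \<Longrightarrow> dist ((f ^^ j) x) ((f ^^ j) y) \<le> \<epsilon>"
  shows "norm (birkhoff_sum f \<psi> n x - birkhoff_sum f \<psi> n y) \<le> real n * v"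
proof -
  have "norm (birkhoff_sum f \<psi> n x - birkhoff_sum f \<psi> n y)
      \<le> (\<Sum>j<n. norm (\<psi> ((f ^^ j) x) - \<psi> ((f ^^ j) y)))"
    unfolding birkhoff_sum_def by (simp flip: sum_subtractf add: norm_sum)
  also have "\<dots> \<le> of_nat (card {..<n}) * v"
    using assms by (intro sum_bounded_above) auto
  finally show ?thesis by simp
qed

lemma bowen_dist_less_iff:
  "0 < n \<Longrightarrow> bowen_dist f n x y < \<epsilon> \<longleftrightarrow> (\<forall>j<n. dist ((f ^^ j) x) ((f ^^ j) y) < \<epsilon>)"
  unfolding bowen_dist_def by (subst Max_less_iff) auto

lemma bowen_dist_le_iff:
  "0 < n \<Longrightarrow> bowen_dist f n x y \<le> \<epsilon> \<longleftrightarrow> (\<forall>j<n. dist ((f ^^ j) x) ((f ^^ j) y) \<le> \<epsilon>)"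
  unfolding bowen_dist_def by (subst Max_le_iff) auto

lemma mem_bowen_ball_iff:
  "0 < n \<Longrightarrow> y \<in> bowen_ball f n x \<epsilon> \<longleftrightarrow> (\<forall>j<n. dist ((f ^^ j) x) ((f ^^ j) y) < \<epsilon>)"
  by (simp add: bowen_ball_def bowen_dist_less_iff)

lemma separated_mono: "separated f n \<epsilon> E \<Longrightarrow> \<epsilon>' \<le> \<epsilon> \<Longrightarrow> separated f n \<epsilon>' E"
  by (force simp: separated_def)

lemma separated_subset: "separated f n \<epsilon> E \<Longrightarrow> E' \<subseteq> E \<Longrightarrow> separated f n \<epsilon> E'"
  by (auto simp: separated_def)

lemma continuous_on_funpow:
  fixes f :: "'a::topological_space \<Rightarrow> 'a"
  assumes "continuous_on UNIV f"
  shows "continuous_on S (f ^^ n)"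
proof (induction n)
  case 0
  show ?case by (simp add: continuous_on_id)
next
  case (Suc n)
  then show ?case
    using continuous_on_compose[of S "f ^^ n" f] assms continuous_on_subset by (simp add: o_def) blast
qed

lemma open_bowen_ball:
  assumes "continuous_on UNIV f" "0 < n"
  shows "open (bowen_ball f n x \<epsilon>)"
proof -
  have "bowen_ball f n x \<epsilon> = (\<Inter>j\<in>{..<n}. {y. dist ((f ^^ j) x) ((f ^^ j) y) < \<epsilon>})"
    using assms by (auto simp: mem_bowen_ball_iff)
  moreover have "open {y. dist ((f ^^ j) x) ((f ^^ j) y) < \<epsilon>}" for j
    by (intro open_Collect_less continuous_intros continuous_on_compose2[OF continuous_on_dist]
        continuous_on_funpow[OF assms(1)])
  ultimately show ?thesis by auto
qed

text \<open>
  Each of finitely many Bowen balls of radius \<open>\<epsilon>/2\<close> covering the space contains at most one point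
  of a separated set.
\<close>

lemma separated_card_bounded:
  fixes f :: "'a::metric_space \<Rightarrow> 'a"
  assumes "compact (UNIV :: 'a set)" "continuous_on UNIV f" "0 < n" "0 < \<epsilon>"
  obtains K where "\<And>E. separated f n \<epsilon> E \<Longrightarrow> finite E \<and> card E \<le> K"
proof -
  have "UNIV \<subseteq> (\<Union>x. bowen_ball f n x (\<epsilon>/2))"
    using assms by (auto simp: mem_bowen_ball_iff intro!: exI)
  then obtain C where C: "finite C" "UNIV \<subseteq> (\<Union>x\<in>C. bowen_ball f n x (\<epsilon>/2))"
    using compactE_image[OF assms(1), of UNIV "\<lambda>x. bowen_ball f n x (\<epsilon>/2)"]
      open_bowen_ball[OF assms(2,3)] by (metis subset_UNIV)
  then have "\<forall>x. \<exists>c\<in>C. x \<in> bowen_ball f n c (\<epsilon>/2)" by auto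
  then obtain c where c: "\<And>x. c x \<in> C" "\<And>x. x \<in> bowen_ball f n (c x) (\<epsilon>/2)" by metis
  have "finite E \<and> card E \<le> card C" if E: "separated f n \<epsilon> E" for E
  proof -
    have "inj_on c E"
    proof (rule inj_onI, rule ccontr)
      fix x y assume xy: "x \<in> E" "y \<in> E" "c x = c y" "x \<noteq> y"
      have "dist ((f ^^ j) x) ((f ^^ j) y) \<le> \<epsilon>" if "j < n" for j
        using c(2)[of x] c(2)[of y] xy(3) that \<open>0 < n\<close>
          dist_triangle3[of "(f ^^ j) x" "(f ^^ j) y" "(f ^^ j) (c x)"]
        by (auto simp: mem_bowen_ball_iff) force
      then have "bowen_dist f n x y \<le> \<epsilon>" using \<open>0 < n\<close> by (simp add: bowen_dist_le_iff)
      with E xy show False by (force simp: separated_def)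
    qed
    then show ?thesis
      using C(1) c(1) by (meson card_inj_on_le image_subsetI inj_on_finite)
  qed
  then show ?thesis using that by blast
qed

section \<open>Separated and spanning sets\<close>

definition separated_sum :: "('a::metric_space \<Rightarrow> 'a) \<Rightarrow> ('a \<Rightarrow> real) \<Rightarrow> nat \<Rightarrow> real \<Rightarrow> real" where
  "separated_sum f \<psi> n \<epsilon> =
    (SUP E\<in>{E. separated f n \<epsilon> E}. \<Sum>x\<in>E. exp (birkhoff_sum f \<psi> n x))"

context
  fixes f :: "'a::metric_space \<Rightarrow> 'a" and \<psi> :: "'a \<Rightarrow> real" and B :: real
  assumes X: "compact (UNIV :: 'a set)" and f: "continuous_on UNIV f"
    and B: "\<And>x. \<bar>\<psi> x\<bar> \<le> B"
begin

lemma birkhoff_sum_bounds: "birkhoff_sum f \<psi> n x \<le> real n * B" "- (real n * B) \<le> birkhoff_sum f \<psi> n x"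
  using norm_birkhoff_sum_le[of \<psi> B f n x] B by auto

lemma bdd_above_separated_sums:
  assumes "0 < n" "0 < \<epsilon>"
  shows "bdd_above ((\<lambda>E. \<Sum>x\<in>E. exp (birkhoff_sum f \<psi> n x)) ` {E. separated f n \<epsilon> E})"
proof -
  obtain K where K: "\<And>E. separated f n \<epsilon> E \<Longrightarrow> finite E \<and> card E \<le> K"
    using separated_card_bounded[OF X f assms] by blast
  have "(\<Sum>x\<in>E. exp (birkhoff_sum f \<psi> n x)) \<le> real K * exp (real n * B)" if "separated f n \<epsilon> E" for E
  proof -
    have "(\<Sum>x\<in>E. exp (birkhoff_sum f \<psi> n x)) \<le> real (card E) * exp (real n * B)"
      using birkhoff_sum_bounds by (intro sum_bounded_above) auto
    also have "\<dots> \<le> real K * exp (real n * B)" using K[OF that] by (intro mult_right_mono) auto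
    finally show ?thesis .
  qed
  then show ?thesis by (intro bdd_aboveI2) auto
qed

lemma separated_sum_upper:
  assumes "0 < n" "0 < \<epsilon>" "separated f n \<epsilon> E"
  shows "(\<Sum>x\<in>E. exp (birkhoff_sum f \<psi> n x)) \<le> separated_sum f \<psi> n \<epsilon>"
  unfolding separated_sum_def using bdd_above_separated_sums assms by (intro cSUP_upper) auto

lemma separated_sum_ge_exp:
  assumes "0 < n" "0 < \<epsilon>"
  shows "exp (- (real n * B)) \<le> separated_sum f \<psi> n \<epsilon>"
proof -
  have "exp (- (real n * B)) \<le> exp (birkhoff_sum f \<psi> n undefined)"
    using birkhoff_sum_bounds(2) by simp
  also have "\<dots> \<le> separated_sum f \<psi> n \<epsilon>"
    using separated_sum_upper[OF assms, of "{undefined}"] by (simp add: separated_def)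
  finally show ?thesis .
qed

lemma separated_sum_pos: "0 < n \<Longrightarrow> 0 < \<epsilon> \<Longrightarrow> 0 < separated_sum f \<psi> n \<epsilon>"
  using separated_sum_ge_exp by (smt (verit) exp_gt_zero)

lemma separated_sum_antimono:
  assumes "0 < n" "0 < \<epsilon>'" "\<epsilon>' \<le> \<epsilon>"
  shows "separated_sum f \<psi> n \<epsilon> \<le> separated_sum f \<psi> n \<epsilon>'"
  unfolding separated_sum_def
proof (rule cSUP_subset_mono)
  have "separated f n \<epsilon> {}" by (simp add: separated_def)
  then show "{E. separated f n \<epsilon> E} \<noteq> {}" by auto
qed (use assms bdd_above_separated_sums[of n \<epsilon>'] separated_mono in auto)

lemma less_separated_sumD:
  assumes "0 < n" "0 < \<epsilon>" "t < separated_sum f \<psi> n \<epsilon>"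
  obtains E where "separated f n \<epsilon> E" "finite E" "t < (\<Sum>x\<in>E. exp (birkhoff_sum f \<psi> n x))"
proof -
  have "separated f n \<epsilon> {}" by (simp add: separated_def)
  then have "\<exists>E. separated f n \<epsilon> E \<and> t < (\<Sum>x\<in>E. exp (birkhoff_sum f \<psi> n x))"
    using assms(3) less_cSUP_iff[OF _ bdd_above_separated_sums[OF assms(1,2)]]
    unfolding separated_sum_def by (metis (mono_tags, lifting) empty_iff mem_Collect_eq)
  then show ?thesis
    using that separated_card_bounded[OF X f assms(1,2)] by metis
qed

text \<open>A separated set of maximal cardinality is spanning.\<close>

lemma bowen_balls_of_separated_cover:
  assumes "0 < n" "0 < \<epsilon>'" "\<epsilon>' < \<epsilon>"
  obtains E where "separated f n \<epsilon>' E" "finite E" "(\<Union>x\<in>E. bowen_ball f n x \<epsilon>) = UNIV"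
proof -
  obtain K where K: "\<And>E. separated f n \<epsilon>' E \<Longrightarrow> finite E \<and> card E \<le> K"
    using separated_card_bounded[OF X f assms(1,2)] by blast
  have "separated f n \<epsilon>' {}" by (simp add: separated_def)
  then obtain E where E: "separated f n \<epsilon>' E" "\<And>E'. separated f n \<epsilon>' E' \<Longrightarrow> card E' \<le> card E"
    using ex_has_greatest_nat[of "separated f n \<epsilon>'" "{}" card "Suc K"] K
    by (metis le_imp_less_Suc)
  have "y \<in> (\<Union>x\<in>E. bowen_ball f n x \<epsilon>)" for y
  proof (rule ccontr)
    assume y: "y \<notin> (\<Union>x\<in>E. bowen_ball f n x \<epsilon>)"
    then have *: "bowen_dist f n x y > \<epsilon>'" if "x \<in> E" for x
      using that assms(3) by (force simp: bowen_ball_def)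
    then have "separated f n \<epsilon>' (insert y E)"
      using E(1) by (auto simp: separated_def bowen_dist_def dist_commute)
    moreover have "y \<notin> E" using y assms by (force simp: mem_bowen_ball_iff)
    ultimately show False using E(2)[of "insert y E"] K[OF E(1)] by auto
  qed
  then show ?thesis using that E(1) K by blast
qed

end

text \<open>
  For zero potential the weighted sum counts points, so that pressure estimates contain estimates of entropy
  at a given scale.
\<close>

lemma separated_sum_zero_eq:
  fixes f :: "'a::metric_space \<Rightarrow> 'a"
  assumes "compact (UNIV :: 'a set)" "continuous_on UNIV f" "0 < n" "0 < \<epsilon>"
  shows "separated_sum f (\<lambda>x. 0) n \<epsilon> = real (max_separated f n \<epsilon>)"
proof -
  obtain K where K: "\<And>E. separated f n \<epsilon> E \<Longrightarrow> finite E \<and> card E \<le> K"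
    using separated_card_bounded[OF assms] by blast
  let ?S = "card ` {E. separated f n \<epsilon> E}"
  have "separated f n \<epsilon> {}" by (simp add: separated_def)
  then have ne: "?S \<noteq> {}" by auto
  have fin: "finite ?S" by (rule finite_subset[of _ "{..K}"]) (use K in auto)
  have "real (Max ?S) = Max (real ` ?S)" using fin ne by (intro mono_Max_commute) (auto simp: mono_def)
  also have "\<dots> = Sup (real ` ?S)" using fin ne by (intro cSup_eq_Max[symmetric]) auto
  finally show ?thesis
    unfolding separated_sum_def max_separated_def by (simp add: birkhoff_sum_def image_image)
qed

section \<open>Covers by Bowen balls: the upper bound\<close>

lemma cover_measure_eq_SUP:
  "cover_measure f Z \<psi> s \<epsilon> = (SUP N. cover_sum_inf f Z \<psi> s \<epsilon> N)"
proof -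
  have "incseq (cover_sum_inf f Z \<psi> s \<epsilon>)"
    unfolding incseq_def cover_sum_inf_def
    by (intro allI impI INF_superset_mono) (auto simp: ball_covers_def split: prod.splits intro: order_trans)
  then show ?thesis
    unfolding cover_measure_def by (intro limI LIMSEQ_SUP)
qed

text \<open>
  The Bowen balls around a maximal separated set cover the whole space, and all have the same length. The covers
  need arbitrarily large lengths, but not all of them, so a subsequence of lengths realising the \<open>liminf\<close>
  suffices; this is what the lower metric mean dimension requires.
\<close>

lemma pressure_at_leI:
  fixes f :: "'a::metric_space \<Rightarrow> 'a" and \<psi> :: "'a \<Rightarrow> real"
  assumes X: "compact (UNIV :: 'a set)" and f: "continuous_on UNIV f"
    and B: "\<And>x. \<bar>\<psi> x\<bar> \<le> B"
    and v: "\<And>x y. dist x y \<le> \<epsilon> \<Longrightarrow> \<bar>\<psi> x - \<psi> y\<bar> \<le> v"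
    and \<epsilon>: "0 < \<epsilon>'" "\<epsilon>' < \<epsilon>"
  shows "pressure_at f Z \<psi> \<epsilon>
    \<le> liminf (\<lambda>n. ereal (1 / real n * ln (separated_sum f \<psi> n \<epsilon>'))) + ereal v"
    (is "_ \<le> liminf ?X + _")
proof (rule ccontr)
  assume "\<not> ?thesis"
  then have "liminf ?X + ereal v < pressure_at f Z \<psi> \<epsilon>" by (simp only: not_le)
  from ereal_dense2[OF this] obtain s
    where s: "liminf ?X + ereal v < ereal s" "ereal s < pressure_at f Z \<psi> \<epsilon>"
    by blast
  then have "liminf ?X < ereal (s - v)"
    by (cases "liminf ?X") auto
  from ereal_dense2[OF this] obtain t where t: "liminf ?X < ereal t" "t < s - v"
    by auto
  have freq: "\<exists>\<^sub>F n in sequentially. ?X n < ereal t"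
  proof (rule ccontr)
    assume "\<not> ?thesis"
    then have "\<forall>\<^sub>F n in sequentially. ereal t \<le> ?X n" by (simp add: not_frequently not_less)
    then have "ereal t \<le> liminf ?X" by (rule Liminf_bounded)
    with t(1) show False by simp
  qed
  define \<theta> where "\<theta> = s - v - t"
  have \<theta>: "\<theta> > 0" using t by (simp add: \<theta>_def)
  have bound: "cover_sum_inf f Z \<psi> s \<epsilon> N \<le> ennreal (exp (- \<theta> * real n))"
    if n: "N \<le> n" "0 < n" "?X n < ereal t" for N n
  proof -
    obtain E where E: "separated f n \<epsilon>' E" "finite E" "(\<Union>x\<in>E. bowen_ball f n x \<epsilon>) = UNIV"
      using bowen_balls_of_separated_cover[OF X f B n(2) \<epsilon>] by blast
    have W: "(\<Sum>x\<in>E. exp (birkhoff_sum f \<psi> n x)) \<le> exp (real n * t)"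
    proof -
      have "(\<Sum>x\<in>E. exp (birkhoff_sum f \<psi> n x)) \<le> separated_sum f \<psi> n \<epsilon>'"
        using separated_sum_upper[OF X f B n(2) \<epsilon>(1) E(1)] .
      also have "\<dots> = exp (ln (separated_sum f \<psi> n \<epsilon>'))"
        using separated_sum_pos[OF X f B n(2) \<epsilon>(1)] by simp
      also have "\<dots> \<le> exp (real n * t)"
        using n(2,3) by (simp add: field_simps)
      finally show ?thesis .
    qed
    let ?cost = "\<lambda>x. exp (- s * real n + (SUP y\<in>bowen_ball f n x \<epsilon>. birkhoff_sum f \<psi> n y))"
    have cost: "?cost x \<le> exp (real n * (v - s)) * exp (birkhoff_sum f \<psi> n x)" for x
    proof -
      have "(SUP y\<in>bowen_ball f n x \<epsilon>. birkhoff_sum f \<psi> n y) \<le> birkhoff_sum f \<psi> n x + real n * v"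
      proof (rule cSUP_least)
        have "x \<in> bowen_ball f n x \<epsilon>" using n \<epsilon> by (simp add: mem_bowen_ball_iff)
        then show "bowen_ball f n x \<epsilon> \<noteq> {}" by blast
        fix y assume "y \<in> bowen_ball f n x \<epsilon>"
        then have "\<bar>birkhoff_sum f \<psi> n x - birkhoff_sum f \<psi> n y\<bar> \<le> real n * v"
          using norm_birkhoff_sum_diff_le[of \<epsilon> \<psi> v n f x y] v n(2)
          by (simp add: mem_bowen_ball_iff less_imp_le)
        then show "birkhoff_sum f \<psi> n y \<le> birkhoff_sum f \<psi> n x + real n * v" by simp
      qed
      then show ?thesis by (simp flip: exp_add add: algebra_simps)
    qed
    have "E \<times> {n} \<in> ball_covers f Z \<epsilon> N"
      using E n by (auto simp: ball_covers_def countable_finite)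
    then have "cover_sum_inf f Z \<psi> s \<epsilon> N \<le> (\<Sum>\<^sub>\<infinity>(x, n)\<in>E \<times> {n}.
       ennreal (exp (- s * real n + (SUP y\<in>bowen_ball f n x \<epsilon>. birkhoff_sum f \<psi> n y))))"
      unfolding cover_sum_inf_def by (rule INF_lower)
    also have "\<dots> = (\<Sum>x\<in>E. ennreal (?cost x))"
      using E(2) by (subst infsum_finite) (auto simp flip: sum.cartesian_product)
    also have "\<dots> = ennreal (\<Sum>x\<in>E. ?cost x)" by (simp add: sum_ennreal)
    also have "\<dots> \<le> ennreal (exp (real n * (v - s)) * (\<Sum>x\<in>E. exp (birkhoff_sum f \<psi> n x)))"
      unfolding sum_distrib_left by (intro ennreal_leI sum_mono cost)
    also have "\<dots> \<le> ennreal (exp (real n * (v - s)) * exp (real n * t))"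
      by (intro ennreal_leI mult_left_mono W) auto
    also have "\<dots> = ennreal (exp (- \<theta> * real n))"
      by (simp add: \<theta>_def algebra_simps flip: exp_add)
    finally show ?thesis .
  qed
  have "cover_sum_inf f Z \<psi> s \<epsilon> N = 0" for N
  proof -
    have "cover_sum_inf f Z \<psi> s \<epsilon> N \<le> 0 + ennreal e" if "e > 0" for e
    proof -
      have "(\<lambda>n. exp (- \<theta> * real n)) \<longlonglongrightarrow> 0"
        using LIMSEQ_power_zero[of "exp (- \<theta>)"] \<theta> by (simp only: exp_of_nat2_mult) simp
      then have "\<forall>\<^sub>F n in sequentially. exp (- \<theta> * real n) < e"
        using that by (rule order_tendstoD)
      then have "\<forall>\<^sub>F n in sequentially. exp (- \<theta> * real n) < e \<and> N \<le> n \<and> 0 < n"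
        using eventually_ge_at_top[of N] eventually_gt_at_top[of 0] by eventually_elim auto
      then obtain n where "?X n < ereal t" "exp (- \<theta> * real n) < e" "N \<le> n" "0 < n"
        using frequently_ex[OF frequently_eventually_frequently[OF freq]] by blast
      then show ?thesis
        using bound[of N n] by (simp add: order_trans[OF _ ennreal_leI])
    qed
    then have "cover_sum_inf f Z \<psi> s \<epsilon> N \<le> 0" by (intro ennreal_le_epsilon[of 0]) simp
    then show ?thesis by simp
  qed
  then have "cover_measure f Z \<psi> s \<epsilon> = 0" by (simp add: cover_measure_eq_SUP)
  then have "pressure_at f Z \<psi> \<epsilon> \<le> ereal s"
    unfolding pressure_at_def by (intro Inf_lower) auto
  with s(2) show False by simp
qed

section \<open>Product measures and covers by cylinders\<close>

lemma infsum_ennreal_cmult: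
  fixes a :: "'i \<Rightarrow> ennreal"
  shows "(\<Sum>\<^sub>\<infinity>i\<in>I. c * a i) = c * (\<Sum>\<^sub>\<infinity>i\<in>I. a i)"
  by (subst (1 2) nonneg_infsum_complete) (auto simp: SUP_mult_left_ennreal sum_distrib_left)

lemma emeasure_le_infsum:
  assumes "countable I" "\<And>i. i \<in> I \<Longrightarrow> A i \<in> sets M" "S \<subseteq> (\<Union>i\<in>I. A i)"
  shows "emeasure M S \<le> (\<Sum>\<^sub>\<infinity>i\<in>I. emeasure M (A i))"
proof -
  let ?r = "to_nat_on I"
  define A' where "A' k = (if k \<in> ?r ` I then A (from_nat_into I k) else {})" for k
  have sets: "range A' \<subseteq> sets M"
    using assms(1,2) by (auto simp: A'_def)
  have un: "(\<Union>i\<in>I. A i) = (\<Union>k. A' k)"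
    using assms(1) by (auto simp: A'_def split: if_splits)
  have "emeasure M S \<le> emeasure M (\<Union>k. A' k)"
    using assms(3) sets unfolding un by (intro emeasure_mono) auto
  also have "\<dots> \<le> (\<Sum>k. emeasure M (A' k))"
    using sets by (rule emeasure_subadditive_countably)
  also have "\<dots> \<le> (\<Sum>\<^sub>\<infinity>i\<in>I. emeasure M (A i))"
  proof (rule suminf_le_const)
    fix K
    let ?F = "{i \<in> I. ?r i < K}"
    have inj: "inj_on ?r ?F" using assms(1) by (auto intro: inj_on_subset[OF inj_on_to_nat_on])
    have F: "finite ?F" using inj_on_finite[OF inj, of "{..<K}"] by auto
    have "(\<Sum>k<K. emeasure M (A' k)) = (\<Sum>k\<in>?r ` ?F. emeasure M (A' k))"
      by (rule sum.mono_neutral_right) (auto simp: A'_def)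
    also have "\<dots> = (\<Sum>i\<in>?F. emeasure M (A i))"
      using assms(1) by (subst sum.reindex[OF inj]) (auto simp: A'_def intro!: sum.cong)
    also have "\<dots> \<le> (\<Sum>\<^sub>\<infinity>i\<in>I. emeasure M (A i))"
      using F by (subst nonneg_infsum_complete) (auto intro!: SUP_upper)
    finally show "(\<Sum>k<K. emeasure M (A' k)) \<le> (\<Sum>\<^sub>\<infinity>i\<in>I. emeasure M (A i))" .
  qed (rule summableI)
  finally show ?thesis .
qed

text \<open>
  The union bound for the infinite power of the probability distribution \<open>w\<close> on \<open>E\<close>. Every index \<open>\<gamma>\<close>
  contributes finitely many cylinders, all of the same length \<open>k \<gamma>\<close>, and each cylinder is given by a sequence
  \<open>c\<close> of which only the first \<open>k \<gamma>\<close> terms matter.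
\<close>

lemma cylinder_cover_sum_ge_1:
  fixes w :: "'a \<Rightarrow> real" and F :: "'i \<Rightarrow> (nat \<Rightarrow> 'a) set" and k :: "'i \<Rightarrow> nat"
  assumes E: "finite E" "\<And>x. x \<in> E \<Longrightarrow> 0 \<le> w x" "(\<Sum>x\<in>E. w x) = 1"
    and I: "countable I" "\<And>\<gamma>. \<gamma> \<in> I \<Longrightarrow> finite (F \<gamma>)" "\<And>\<gamma> c i. \<gamma> \<in> I \<Longrightarrow> c \<in> F \<gamma> \<Longrightarrow> c i \<in> E"
    and cover: "\<And>\<omega>. (\<forall>i. \<omega> i \<in> E) \<Longrightarrow> \<exists>\<gamma>\<in>I. \<exists>c\<in>F \<gamma>. \<forall>i<k \<gamma>. \<omega> i = c i"
  shows "1 \<le> (\<Sum>\<^sub>\<infinity>\<gamma>\<in>I. ennreal (\<Sum>c\<in>F \<gamma>. \<Prod>i<k \<gamma>. w (c i)))"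
proof -
  define M where "M = point_measure E (\<lambda>x. ennreal (w x))"
  have em: "emeasure M A = ennreal (\<Sum>x\<in>A. w x)" if "A \<subseteq> E" for A
    using that E unfolding M_def
    by (subst emeasure_point_measure_finite) (auto intro!: sum_ennreal)
  have sp: "space M = E" "sets M = Pow E"
    by (simp_all add: M_def space_point_measure sets_point_measure)
  have "prob_space M" using em[of E] E sp by (intro prob_spaceI) simp
  then interpret P: product_prob_space "\<lambda>_::nat. M" UNIV
    by (simp add: product_prob_space_def product_prob_space_axioms_def product_sigma_finite_def
        prob_space_imp_sigma_finite)
  let ?P = "Pi\<^sub>M UNIV (\<lambda>_::nat. M)"
  define cyl where "cyl c n = prod_emb UNIV (\<lambda>_::nat. M) {..<n} (Pi\<^sub>E {..<n} (\<lambda>i. {c i}))" for c :: "nat \<Rightarrow> 'a" and n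
  have cyl: "emeasure ?P (cyl c n) = ennreal (\<Prod>i<n. w (c i))" "cyl c n \<in> sets ?P"
    if "\<And>i. c i \<in> E" for c n
  proof -
    show "emeasure ?P (cyl c n) = ennreal (\<Prod>i<n. w (c i))"
      unfolding cyl_def using that E(2)
      by (subst P.emeasure_PiM_emb) (auto simp: sp em prod_ennreal)
    show "cyl c n \<in> sets ?P"
      unfolding cyl_def using that by (intro sets_PiM_I) (auto simp: sp)
  qed
  have "1 = emeasure ?P (space ?P)" using P.emeasure_space_1 by simp
  also have "\<dots> \<le> (\<Sum>\<^sub>\<infinity>\<gamma>\<in>I. emeasure ?P (\<Union>c\<in>F \<gamma>. cyl c (k \<gamma>)))"
  proof (rule emeasure_le_infsum[OF I(1)])
    show "(\<Union>c\<in>F \<gamma>. cyl c (k \<gamma>)) \<in> sets ?P" if "\<gamma> \<in> I" for \<gamma>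
      using that I cyl by (intro sets.finite_UN) auto
    show "space ?P \<subseteq> (\<Union>\<gamma>\<in>I. \<Union>c\<in>F \<gamma>. cyl c (k \<gamma>))"
    proof
      fix \<omega> assume "\<omega> \<in> space ?P"
      then have \<omega>: "\<And>i. \<omega> i \<in> E" by (auto simp: space_PiM sp)
      then obtain \<gamma> c where "\<gamma> \<in> I" "c \<in> F \<gamma>" "\<forall>i<k \<gamma>. \<omega> i = c i" using cover by blast
      moreover from this have "\<omega> \<in> cyl c (k \<gamma>)"
        using \<omega> by (auto simp: cyl_def prod_emb_def sp PiE_def extensional_def)
      ultimately show "\<omega> \<in> (\<Union>\<gamma>\<in>I. \<Union>c\<in>F \<gamma>. cyl c (k \<gamma>))" by blast
    qed
  qed
  also have "\<dots> \<le> (\<Sum>\<^sub>\<infinity>\<gamma>\<in>I. ennreal (\<Sum>c\<in>F \<gamma>. \<Prod>i<k \<gamma>. w (c i)))"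
  proof (intro infsum_mono nonneg_summable_on_complete)
    fix \<gamma> assume \<gamma>: "\<gamma> \<in> I"
    have "emeasure ?P (\<Union>c\<in>F \<gamma>. cyl c (k \<gamma>)) \<le> (\<Sum>c\<in>F \<gamma>. emeasure ?P (cyl c (k \<gamma>)))"
      using \<gamma> I cyl by (intro emeasure_subadditive_finite) auto
    also have "\<dots> = (\<Sum>c\<in>F \<gamma>. ennreal (\<Prod>i<k \<gamma>. w (c i)))"
      using \<gamma> I cyl by (intro sum.cong) auto
    also have "\<dots> = ennreal (\<Sum>c\<in>F \<gamma>. \<Prod>i<k \<gamma>. w (c i))"
      using \<gamma> I E(2) by (intro sum_ennreal prod_nonneg) auto
    finally show "emeasure ?P (\<Union>c\<in>F \<gamma>. cyl c (k \<gamma>)) \<le> ennreal (\<Sum>c\<in>F \<gamma>. \<Prod>i<k \<gamma>. w (c i))" .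
  qed auto
  finally show ?thesis .
qed

section \<open>Pressure of a set of concatenated orbits\<close>

text \<open>
  Along a segment of length \<open>n i\<close> the orbit of \<open>y\<close> is close to that of \<open>x i\<close>, which costs \<open>v\<close> per step; along
  a gap of length \<open>p i\<close> only the trivial bound \<open>B\<close> per step is available.
\<close>

lemma birkhoff_sum_concatenation:
  fixes \<psi> :: "'a::metric_space \<Rightarrow> 'b::real_normed_vector" and n p :: "nat \<Rightarrow> nat"
  defines "T \<equiv> \<lambda>k. \<Sum>l<k. n l + p l"
  assumes v: "\<And>x y. dist x y \<le> \<epsilon> \<Longrightarrow> norm (\<psi> x - \<psi> y) \<le> v"
    and B: "\<And>x. norm (\<psi> x) \<le> B"
    and shadow: "\<And>i j. i < k \<Longrightarrow> j < n i \<Longrightarrow> dist ((f ^^ (j + T i)) y) ((f ^^ j) (x i)) \<le> \<epsilon>"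
  shows "norm (birkhoff_sum f \<psi> (T k) y - (\<Sum>i<k. birkhoff_sum f \<psi> (n i) (x i)))
    \<le> (\<Sum>i<k. real (n i) * v + real (p i) * B)"
  using shadow
proof (induction k)
  case 0
  show ?case by (simp add: T_def birkhoff_sum_def)
next
  case (Suc k)
  let ?z = "(f ^^ T k) y"
  have "T (Suc k) = T k + (n k + p k)" by (simp add: T_def)
  then have eq: "birkhoff_sum f \<psi> (T (Suc k)) y = birkhoff_sum f \<psi> (T k) y
      + birkhoff_sum f \<psi> (n k) ?z + birkhoff_sum f \<psi> (p k) ((f ^^ n k) ?z)"
    by (simp add: birkhoff_sum_add)
  have "norm (birkhoff_sum f \<psi> (n k) ?z - birkhoff_sum f \<psi> (n k) (x k)) \<le> real (n k) * v"
    using Suc.prems[of k] by (intro norm_birkhoff_sum_diff_le[OF v]) (auto simp: funpow_add)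
  moreover have "norm (birkhoff_sum f \<psi> (p k) ((f ^^ n k) ?z)) \<le> real (p k) * B"
    by (rule norm_birkhoff_sum_le[OF B])
  moreover have "norm (birkhoff_sum f \<psi> (T k) y - (\<Sum>i<k. birkhoff_sum f \<psi> (n i) (x i)))
      \<le> (\<Sum>i<k. real (n i) * v + real (p i) * B)"
    using Suc.prems by (intro Suc.IH) auto
  moreover have "birkhoff_sum f \<psi> (T (Suc k)) y - (\<Sum>i<Suc k. birkhoff_sum f \<psi> (n i) (x i))
      = (birkhoff_sum f \<psi> (T k) y - (\<Sum>i<k. birkhoff_sum f \<psi> (n i) (x i)))
        + (birkhoff_sum f \<psi> (n k) ?z - birkhoff_sum f \<psi> (n k) (x k))
        + birkhoff_sum f \<psi> (p k) ((f ^^ n k) ?z)"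
    by (simp add: eq)
  ultimately show ?case
    by (simp only: sum.lessThan_Suc add.assoc[symmetric, of "sum _ _"] norm_triangle_mono)
qed

lemma pressure_at_geI:
  assumes "\<And>s N. s < t \<Longrightarrow> 1 \<le> N \<Longrightarrow> c s \<le> cover_sum_inf f Z \<psi> s \<epsilon> N" "\<And>s. 0 < c s"
  shows "ereal t \<le> pressure_at f Z \<psi> \<epsilon>"
  unfolding pressure_at_def
proof (rule Inf_greatest)
  fix a assume "a \<in> ereal ` {s. cover_measure f Z \<psi> s \<epsilon> = 0}"
  then obtain s where s: "a = ereal s" "cover_measure f Z \<psi> s \<epsilon> = 0" by auto
  have "cover_sum_inf f Z \<psi> s \<epsilon> 1 \<le> cover_measure f Z \<psi> s \<epsilon>"
    unfolding cover_measure_eq_SUP by (rule SUP_upper) simp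
  with s assms(1)[of s 1] assms(2)[of s] have "\<not> s < t" by (auto simp: le_zero_eq)
  then show "ereal t \<le> a" using s by simp
qed

text \<open>
  The number on the left is the exponential growth rate of the weighted number of words over \<open>E\<close>, per unit of
  time of one period \<open>n + g\<close>, after a loss of \<open>ln (g + 1)\<close> for the choice of the gap, of \<open>n v\<close> for shadowing
  and of \<open>g B\<close> for the potential along the gap.

  Let \<open>\<Gamma>\<close> be a cover. A ball of length \<open>L\<close> sees \<open>k = L div (n + g)\<close> complete words whatever the gaps are.
  Two sequences with the same first \<open>k\<close> gaps whose glued points lie in that ball agree up to \<open>k\<close>,
  because their words are \<open>4\<epsilon>\<close>-close: \<open>\<epsilon>\<close> for each shadowing and \<open>2\<epsilon>\<close> for the ball. Hence the ball accounts
  for at most \<open>(g + 1)^k\<close> cylinders. For \<open>s\<close> below the bound, their total measure is at most a constant times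
  the cost of the ball, since the supremum in the cost is at least the Birkhoff sum of the glued point. By \<open>cylinder_cover_sum_ge_1\<close> the
  total cost is bounded below, uniformly in \<open>\<Gamma>\<close>.
\<close>

lemma pressure_at_ge_of_concatenations:
  fixes f :: "'a::metric_space \<Rightarrow> 'a" and \<psi> :: "'a \<Rightarrow> real" and n g :: nat
  assumes B: "\<And>x. \<bar>\<psi> x\<bar> \<le> B"
    and v: "\<And>x y. dist x y \<le> \<epsilon> \<Longrightarrow> \<bar>\<psi> x - \<psi> y\<bar> \<le> v"
    and n: "0 < n"
    and E: "finite E" "E \<noteq> {}" "separated f n (4 * \<epsilon>) E"
    and glue: "\<And>\<omega> :: nat \<Rightarrow> 'a. \<forall>i. \<omega> i \<in> E \<Longrightarrow> \<exists>y\<in>Z. \<exists>p. (\<forall>i. p i \<le> g) \<and>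
      (\<forall>i. \<forall>j<n. dist ((f ^^ (j + (\<Sum>l<i. n + p l))) y) ((f ^^ j) (\<omega> i)) \<le> \<epsilon>)"
  shows "ereal ((ln (\<Sum>x\<in>E. exp (birkhoff_sum f \<psi> n x)) - ln (real g + 1) - real n * v - real g * B)
    / real (n + g)) \<le> pressure_at f Z \<psi> \<epsilon>"
proof -
  define W where "W = (\<Sum>x\<in>E. exp (birkhoff_sum f \<psi> n x))"
  define D where "D = n + g"
  define A where "A = ln W - ln (real g + 1) - real n * v - real g * B"
  \<comment> \<open>What the incomplete last period of a ball can contribute; it does not grow with the length.\<close>
  define C where "C s = exp (real D * (\<bar>s\<bar> + B))" for s
  have W: "0 < W" unfolding W_def using E by (intro sum_pos) auto
  have B0: "0 \<le> B" using B[of undefined] by linarith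
  have D: "0 < D" using n by (simp add: D_def)
  define w where "w x = exp (birkhoff_sum f \<psi> n x) / W" for x
  define good where "good \<omega> = (\<lambda>(y, p :: nat \<Rightarrow> nat). y \<in> Z \<and> (\<forall>i. p i \<le> g) \<and>
      (\<forall>i. \<forall>j<n. dist ((f ^^ (j + (\<Sum>l<i. n + p l))) y) ((f ^^ j) (\<omega> i)) \<le> \<epsilon>))" for \<omega> :: "nat \<Rightarrow> 'a"
  have "\<exists>yp. (\<forall>i. \<omega> i \<in> E) \<longrightarrow> good \<omega> yp" for \<omega>
  proof (cases "\<forall>i. \<omega> i \<in> E")
    case True
    from glue[OF this] obtain y p where "good \<omega> (y, p)" unfolding good_def prod.case by blast
    then show ?thesis by blast
  qed blast
  then obtain yp where yp: "\<And>\<omega>. \<forall>i. \<omega> i \<in> E \<Longrightarrow> good \<omega> (yp \<omega>)"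
    by metis
  define y p where "y \<omega> = fst (yp \<omega>)" and "p \<omega> = snd (yp \<omega>)" for \<omega>
  have y: "y \<omega> \<in> Z" and p: "p \<omega> i \<le> g"
    and shadow: "j < n \<Longrightarrow> dist ((f ^^ (j + (\<Sum>l<i. n + p \<omega> l))) (y \<omega>)) ((f ^^ j) (\<omega> i)) \<le> \<epsilon>"
    if "\<forall>i. \<omega> i \<in> E" for \<omega> i j
    using yp[OF that] by (auto simp: good_def y_def p_def case_prod_unfold)
  have "ereal (A / D) \<le> pressure_at f Z \<psi> \<epsilon>"
  proof (rule pressure_at_geI[where c = "\<lambda>s. ennreal (1 / C s)"])
    fix s :: real and N :: nat
    assume s: "s < A / D" and N: "1 \<le> N"
    show "ennreal (1 / C s) \<le> cover_sum_inf f Z \<psi> s \<epsilon> N"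
      unfolding cover_sum_inf_def
    proof (rule INF_greatest)
      fix \<Gamma> assume "\<Gamma> \<in> ball_covers f Z \<epsilon> N"
      then have count: "countable \<Gamma>" and len: "\<And>c n'. (c, n') \<in> \<Gamma> \<Longrightarrow> 0 < n'"
        and cov: "Z \<subseteq> (\<Union>(c, n')\<in>\<Gamma>. bowen_ball f n' c \<epsilon>)"
        using N by (auto simp: ball_covers_def)
      define k where "k \<gamma> = snd \<gamma> div D" for \<gamma> :: "'a \<times> nat"
      define cost where "cost \<gamma> = exp (- s * real (snd \<gamma>) +
        (SUP z\<in>bowen_ball f (snd \<gamma>) (fst \<gamma>) \<epsilon>. birkhoff_sum f \<psi> (snd \<gamma>) z))" for \<gamma> :: "'a \<times> nat"
      define hit where "hit \<gamma> q = {\<omega>. (\<forall>i. \<omega> i \<in> E) \<and> y \<omega> \<in> bowen_ball f (snd \<gamma>) (fst \<gamma>) \<epsilon> \<and>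
        restrict (p \<omega>) {..<k \<gamma>} = q}" for \<gamma> :: "'a \<times> nat" and q
      define gaps where "gaps \<gamma> = {..<k \<gamma>} \<rightarrow>\<^sub>E {..g}" for \<gamma> :: "'a \<times> nat"
      \<comment> \<open>One representative sequence for every gap vector that occurs for the ball.\<close>
      define F where "F \<gamma> = (\<lambda>q. SOME \<omega>. \<omega> \<in> hit \<gamma> q) ` {q \<in> gaps \<gamma>. hit \<gamma> q \<noteq> {}}" for \<gamma>
      have fin_gaps: "finite (gaps \<gamma>)" "card (gaps \<gamma>) = (g + 1) ^ k \<gamma>" for \<gamma>
        unfolding gaps_def by (auto intro!: finite_PiE simp: card_PiE)
      have finF: "finite (F \<gamma>)" for \<gamma> using fin_gaps by (simp add: F_def)
      have cardF: "card (F \<gamma>) \<le> (g + 1) ^ k \<gamma>" for \<gamma>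
      proof -
        have "card (F \<gamma>) \<le> card {q \<in> gaps \<gamma>. hit \<gamma> q \<noteq> {}}"
          unfolding F_def using fin_gaps by (intro card_image_le) auto
        also have "\<dots> \<le> card (gaps \<gamma>)" using fin_gaps by (intro card_mono) auto
        finally show ?thesis using fin_gaps by simp
      qed
      have some: "(SOME \<omega>. \<omega> \<in> hit \<gamma> q) \<in> hit \<gamma> q" if "hit \<gamma> q \<noteq> {}" for \<gamma> q
        using that some_in_eq by blast
      have F_word: "c i \<in> E" and F_ball: "y c \<in> bowen_ball f (snd \<gamma>) (fst \<gamma>) \<epsilon>"
        if c: "c \<in> F \<gamma>" for c \<gamma> i
      proof -
        obtain q where "c = (SOME \<omega>. \<omega> \<in> hit \<gamma> q)" "hit \<gamma> q \<noteq> {}"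
          using c unfolding F_def by blast
        then have "c \<in> hit \<gamma> q" using some[of \<gamma> q] by simp
        then show "c i \<in> E" "y c \<in> bowen_ball f (snd \<gamma>) (fst \<gamma>) \<epsilon>" by (simp_all add: hit_def)
      qed
      have time: "(\<Sum>l<i. n + p \<omega> l) \<le> i * D" if "\<forall>i. \<omega> i \<in> E" for \<omega> i
        using sum_bounded_above[of "{..<i}" "\<lambda>l. n + p \<omega> l" D] p[OF that] by (simp add: D_def)
      have agree: "\<omega> i = \<omega>' i"
        if \<omega>: "\<omega> \<in> hit \<gamma> q" "\<omega>' \<in> hit \<gamma> q" and i: "i < k \<gamma>" and pos: "0 < snd \<gamma>" for \<omega> \<omega>' \<gamma> q i
      proof (rule ccontr)
        assume ne: "\<omega> i \<noteq> \<omega>' i"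
        have E\<omega>: "\<forall>i. \<omega> i \<in> E" "\<forall>i. \<omega>' i \<in> E" using \<omega> by (auto simp: hit_def)
        have "p \<omega> l = p \<omega>' l" if "l < k \<gamma>" for l
        proof -
          have "restrict (p \<omega>) {..<k \<gamma>} = restrict (p \<omega>') {..<k \<gamma>}" using \<omega> by (simp add: hit_def)
          from fun_cong[OF this, of l] that show ?thesis by simp
        qed
        then have T: "(\<Sum>l<i. n + p \<omega> l) = (\<Sum>l<i. n + p \<omega>' l)" (is "?T = _")
          using i by (intro sum.cong) auto
        have "i * D + D \<le> snd \<gamma>"
        proof -
          have "Suc i * D \<le> snd \<gamma> div D * D" using i unfolding k_def by (intro mult_le_mono1) simp
          also have "\<dots> \<le> snd \<gamma>" by simp
          finally show ?thesis by simp
        qed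
        then have last: "j + ?T < snd \<gamma>" if "j < n" for j
          using that time[OF E\<omega>(1), of i] by (simp add: D_def)
        have "dist ((f ^^ j) (\<omega> i)) ((f ^^ j) (\<omega>' i)) \<le> 4 * \<epsilon>" if j: "j < n" for j
        proof -
          let ?a = "(f ^^ (j + ?T)) (y \<omega>)" and ?b = "(f ^^ (j + ?T)) (y \<omega>')"
            and ?c = "(f ^^ (j + ?T)) (fst \<gamma>)"
          have "dist ?c ?a < \<epsilon>" "dist ?c ?b < \<epsilon>"
            using \<omega> last[OF j] pos by (auto simp: hit_def mem_bowen_ball_iff)
          moreover have "dist ?a ((f ^^ j) (\<omega> i)) \<le> \<epsilon>" "dist ?b ((f ^^ j) (\<omega>' i)) \<le> \<epsilon>"
            using shadow[OF E\<omega>(1) j, of i] shadow[OF E\<omega>(2) j, of i] T by auto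
          ultimately show ?thesis
            using dist_triangle3[of "(f ^^ j) (\<omega> i)" "(f ^^ j) (\<omega>' i)" ?a]
              dist_triangle[of ?a "(f ^^ j) (\<omega>' i)" ?b] dist_triangle3[of ?a ?b ?c]
            by linarith
        qed
        then have "bowen_dist f n (\<omega> i) (\<omega>' i) \<le> 4 * \<epsilon>" using n by (simp add: bowen_dist_le_iff)
        with E(3) E\<omega> ne show False by (force simp: separated_def)
      qed
      have weight: "(\<Prod>i<k \<gamma>. w (c i)) * (real g + 1) ^ k \<gamma> \<le> C s * cost \<gamma>"
        if \<gamma>: "\<gamma> \<in> \<Gamma>" and c: "c \<in> F \<gamma>" for \<gamma> c
      proof -
        define L where "L = snd \<gamma>"
        define K where "K = k \<gamma>"
        define T where "T = (\<Sum>l<K. n + p c l)"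
        define S where "S = (\<Sum>i<K. birkhoff_sum f \<psi> n (c i))"
        have E\<omega>: "\<forall>i. c i \<in> E" using F_word[OF c] by blast
        have L: "0 < L" using len[of "fst \<gamma>" "snd \<gamma>"] \<gamma> by (simp add: L_def)
        have KD: "L = K * D + L mod D" by (simp add: K_def k_def L_def)
        then have TL: "T \<le> L" using time[OF E\<omega>, of K] by (simp add: T_def)
        have T: "real T = real K * real n + (\<Sum>l<K. real (p c l))" by (simp add: T_def sum.distrib)
        have "\<bar>birkhoff_sum f \<psi> T (y c) - S\<bar> \<le> (\<Sum>i<K. real n * v + real (p c i) * B)"
          unfolding T_def S_def
          using birkhoff_sum_concatenation[where n = "\<lambda>_. n" and p = "p c" and y = "y c" and x = c
              and \<epsilon> = \<epsilon> and \<psi> = \<psi> and v = v and B = B and k = K and f = f] v B shadow[OF E\<omega>]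
          by simp
        also have "\<dots> = real K * real n * v + (real T - real K * real n) * B"
          by (simp add: T sum.distrib sum_distrib_right)
        finally have S: "S - real K * real n * v - (real T - real K * real n) * B \<le> birkhoff_sum f \<psi> T (y c)"
          by linarith
        have "- ((real L - real T) * B) \<le> birkhoff_sum f \<psi> (L - T) ((f ^^ T) (y c))"
          using norm_birkhoff_sum_le[of \<psi> B f "L - T" "(f ^^ T) (y c)"] B TL by (simp add: of_nat_diff abs_le_iff)
        moreover have "birkhoff_sum f \<psi> L (y c) = birkhoff_sum f \<psi> T (y c) + birkhoff_sum f \<psi> (L - T) ((f ^^ T) (y c))"
          using birkhoff_sum_add[of f \<psi> T "L - T"] TL by simp
        moreover have "birkhoff_sum f \<psi> L (y c) \<le> (SUP z\<in>bowen_ball f L (fst \<gamma>) \<epsilon>. birkhoff_sum f \<psi> L z)"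
        proof (rule cSUP_upper)
          show "y c \<in> bowen_ball f L (fst \<gamma>) \<epsilon>" using F_ball[OF c] by (simp add: L_def)
          show "bdd_above (birkhoff_sum f \<psi> L ` bowen_ball f L (fst \<gamma>) \<epsilon>)"
            using norm_birkhoff_sum_le[of \<psi> B f L] B by (intro bdd_aboveI2[of _ _ "real L * B"]) (auto simp: abs_le_iff)
        qed
        ultimately have SUP: "S - real K * real n * v - (real L - real K * real n) * B
            \<le> (SUP z\<in>bowen_ball f L (fst \<gamma>) \<epsilon>. birkhoff_sum f \<psi> L z)"
          using S by (simp add: algebra_simps)
        have Lr: "real L = real K * real D + real (L mod D)"
          using KD by (metis of_nat_add of_nat_mult)
        \<comment> \<open>The complete periods contribute a nonpositive exponent, by the choice of \<open>s\<close>.\<close>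
        have "s * real D \<le> A" using s D by (simp add: field_simps)
        then have "real K * (s * real D - A) \<le> 0" by (intro mult_nonneg_nonpos) auto
        moreover have "real (L mod D) * (s + B) \<le> real D * (\<bar>s\<bar> + B)"
          by (rule order_trans[OF mult_left_mono[of _ "\<bar>s\<bar> + B"] mult_right_mono])
            (use D B0 in \<open>auto intro: less_imp_le\<close>)
        moreover have "S - real K * ln W + real K * ln (real g + 1)
            = real K * (s * real D - A) + real (L mod D) * (s + B)
              - s * real L + (S - real K * real n * v - (real L - real K * real n) * B)"
          by (simp add: Lr A_def D_def algebra_simps)
        ultimately have main: "S - real K * ln W + real K * ln (real g + 1)
            \<le> real D * (\<bar>s\<bar> + B) + (- s * real L + (SUP z\<in>bowen_ball f L (fst \<gamma>) \<epsilon>. birkhoff_sum f \<psi> L z))"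
          using SUP by simp
        have "(\<Prod>i<K. w (c i)) * (real g + 1) ^ K = exp (S - real K * ln W + real K * ln (real g + 1))"
          using W by (simp add: w_def S_def exp_add exp_diff exp_sum prod_dividef exp_of_nat_mult)
        also have "\<dots> \<le> C s * cost \<gamma>"
          using main by (simp add: C_def cost_def L_def flip: exp_add)
        finally show ?thesis by (simp add: K_def)
      qed
      have "1 \<le> (\<Sum>\<^sub>\<infinity>\<gamma>\<in>\<Gamma>. ennreal (\<Sum>c\<in>F \<gamma>. \<Prod>i<k \<gamma>. w (c i)))"
      proof (rule cylinder_cover_sum_ge_1[where E = E])
        show "finite E" "countable \<Gamma>" "finite (F \<gamma>)" for \<gamma> by (fact E(1) count finF)+
        show "c i \<in> E" if "c \<in> F \<gamma>" for \<gamma> c i using F_word[OF that] .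
        show "0 \<le> w x" for x using W by (simp add: w_def)
        show "(\<Sum>x\<in>E. w x) = 1" using W by (simp add: w_def W_def flip: sum_divide_distrib)
        fix \<omega> :: "nat \<Rightarrow> 'a" assume \<omega>: "\<forall>i. \<omega> i \<in> E"
        then obtain \<gamma> where \<gamma>: "\<gamma> \<in> \<Gamma>" "y \<omega> \<in> bowen_ball f (snd \<gamma>) (fst \<gamma>) \<epsilon>"
          using y[of \<omega>] cov by fastforce
        let ?q = "restrict (p \<omega>) {..<k \<gamma>}"
        have hit: "\<omega> \<in> hit \<gamma> ?q" using \<omega> \<gamma> by (simp add: hit_def)
        have "?q \<in> gaps \<gamma>" using p[of \<omega>] \<omega> by (auto simp: gaps_def)
        then have "(SOME \<omega>. \<omega> \<in> hit \<gamma> ?q) \<in> F \<gamma>" using hit by (auto simp: F_def)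
        moreover have "\<omega> i = (SOME \<omega>. \<omega> \<in> hit \<gamma> ?q) i" if "i < k \<gamma>" for i
          using agree[OF hit some that] hit len[of "fst \<gamma>" "snd \<gamma>"] \<gamma>(1) by auto
        ultimately show "\<exists>\<gamma>\<in>\<Gamma>. \<exists>c\<in>F \<gamma>. \<forall>i<k \<gamma>. \<omega> i = c i" using \<gamma>(1) by blast
      qed
      also have "\<dots> \<le> (\<Sum>\<^sub>\<infinity>\<gamma>\<in>\<Gamma>. ennreal (C s) * ennreal (cost \<gamma>))"
      proof (intro infsum_mono nonneg_summable_on_complete)
        fix \<gamma> assume \<gamma>: "\<gamma> \<in> \<Gamma>"
        have "(\<Sum>c\<in>F \<gamma>. \<Prod>i<k \<gamma>. w (c i)) \<le> real (card (F \<gamma>)) * (C s * cost \<gamma> / (real g + 1) ^ k \<gamma>)"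
          using weight[OF \<gamma>] by (intro sum_bounded_above) (simp add: field_simps)
        also have "\<dots> \<le> (real g + 1) ^ k \<gamma> * (C s * cost \<gamma> / (real g + 1) ^ k \<gamma>)"
          using of_nat_mono[OF cardF[of \<gamma>], where 'a = real]
          by (intro mult_right_mono) (auto simp: C_def cost_def add.commute)
        also have "\<dots> = C s * cost \<gamma>" by simp
        finally show "ennreal (\<Sum>c\<in>F \<gamma>. \<Prod>i<k \<gamma>. w (c i)) \<le> ennreal (C s) * ennreal (cost \<gamma>)"
          by (simp add: C_def cost_def ennreal_leI flip: ennreal_mult)
      qed auto
      also have "\<dots> = ennreal (C s) * (\<Sum>\<^sub>\<infinity>\<gamma>\<in>\<Gamma>. ennreal (cost \<gamma>))"
        by (rule infsum_ennreal_cmult)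
      finally have "ennreal (1 / C s) * 1 \<le> ennreal (1 / C s) * (ennreal (C s) * (\<Sum>\<^sub>\<infinity>\<gamma>\<in>\<Gamma>. ennreal (cost \<gamma>)))"
        by (rule mult_left_mono) simp
      also have "\<dots> = (\<Sum>\<^sub>\<infinity>\<gamma>\<in>\<Gamma>. ennreal (cost \<gamma>))"
        by (simp add: C_def mult.assoc[symmetric] flip: ennreal_mult exp_add)
      finally show "ennreal (1 / C s) \<le> (\<Sum>\<^sub>\<infinity>(x, n)\<in>\<Gamma>. ennreal (exp (- s * real n +
          (SUP y\<in>bowen_ball f n x \<epsilon>. birkhoff_sum f \<psi> n y))))"
        by (simp add: cost_def case_prod_unfold)
    qed
  qed (simp add: C_def)
  then show ?thesis by (simp add: A_def D_def W_def)
qed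

section \<open>Gluing infinitely many orbit segments\<close>

text \<open>
  A limit of finite gluings: the gaps range over the compact space of sequences bounded by \<open>m\<close>, where
  convergence means that every single gap is eventually constant.
\<close>

lemma gluing_orbit_property_infinite:
  fixes f :: "'a::metric_space \<Rightarrow> 'a"
  assumes X: "compact (UNIV :: 'a set)" and f: "continuous_on UNIV f"
    and "gluing_orbit_property f" and "0 < \<epsilon>"
  obtains m where "\<And>(x :: nat \<Rightarrow> 'a) (n :: nat \<Rightarrow> nat). \<forall>i. 1 \<le> n i \<Longrightarrow>
    \<exists>(p :: nat \<Rightarrow> nat) y. (\<forall>i. p i \<le> m) \<and>
      (\<forall>i. \<forall>j\<le>n i. dist ((f ^^ (j + (\<Sum>l<i. n l + p l))) y) ((f ^^ j) (x i)) \<le> \<epsilon>)"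
proof -
  obtain m where m: "\<forall>k\<ge>1. \<forall>(x :: nat \<Rightarrow> 'a) (n :: nat \<Rightarrow> nat). (\<forall>i\<in>{1..k}. n i \<ge> 1) \<longrightarrow>
      (\<exists>(p :: nat \<Rightarrow> nat) y. (\<forall>i\<in>{1..<k}. p i \<le> m) \<and>
        (\<forall>i\<in>{1..k}. \<forall>j\<le>n i.
          dist ((f ^^ (j + (\<Sum>l\<in>{1..<i}. n l + p l))) y) ((f ^^ j) (x i)) \<le> \<epsilon>))"
    using assms(3)[unfolded gluing_orbit_property_def, THEN spec, THEN mp, OF assms(4)] by (elim exE conjE)
  have "\<exists>(p :: nat \<Rightarrow> nat) y. (\<forall>i. p i \<le> m) \<and>
      (\<forall>i. \<forall>j\<le>n i. dist ((f ^^ (j + (\<Sum>l<i. n l + p l))) y) ((f ^^ j) (x i)) \<le> \<epsilon>)"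
    if n: "\<forall>i. 1 \<le> n i" for x :: "nat \<Rightarrow> 'a" and n :: "nat \<Rightarrow> nat"
  proof -
    define tracks where "tracks i p y \<longleftrightarrow>
      (\<forall>j\<le>n i. dist ((f ^^ (j + (\<Sum>l<i. n l + p l))) y) ((f ^^ j) (x i)) \<le> \<epsilon>)" for i p y
    have finite_gluing: "\<exists>z. (\<forall>i. fst z i \<le> m) \<and> (\<forall>i\<le>k. tracks i (fst z) (snd z))" for k
    proof -
      have "\<exists>(p :: nat \<Rightarrow> nat) y. (\<forall>i\<in>{1..<Suc k}. p i \<le> m) \<and>
        (\<forall>i\<in>{1..Suc k}. \<forall>j\<le>n (i - 1). dist ((f ^^ (j + (\<Sum>l\<in>{1..<i}. n (l - 1) + p l))) y)
          ((f ^^ j) (x (i - 1))) \<le> \<epsilon>)"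
        using n by (intro m[THEN spec, THEN mp, THEN spec, THEN spec, THEN mp]) auto
      then obtain p y where py: "\<forall>i\<in>{1..<Suc k}. p i \<le> m"
        "\<forall>i\<in>{1..Suc k}. \<forall>j\<le>n (i - 1). dist ((f ^^ (j + (\<Sum>l\<in>{1..<i}. n (l - 1) + p l))) y)
          ((f ^^ j) (x (i - 1))) \<le> \<epsilon>"
        by (elim exE conjE)
      \<comment> \<open>No segment follows the last one, so the gaps from there on are set to \<open>0\<close>.\<close>
      define p' where "p' i = (if i < k then p (Suc i) else 0)" for i
      have "tracks i p' y" if i: "i \<le> k" for i
      proof -
        have "(\<Sum>l\<in>{1..<Suc i}. n (l - 1) + p l) = (\<Sum>l<i. n l + p (Suc l))"
          by (simp only: One_nat_def sum.shift_bounds_Suc_ivl lessThan_atLeast0) simp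
        also have "\<dots> = (\<Sum>l<i. n l + p' l)" using i by (intro sum.cong) (auto simp: p'_def)
        finally show ?thesis using py(2)[THEN bspec, of "Suc i"] i by (simp add: tracks_def)
      qed
      moreover have "p' i \<le> m" for i using py(1)[THEN bspec, of "Suc i"] by (simp add: p'_def)
      ultimately show ?thesis by (intro exI[of _ "(p', y)"]) simp
    qed
    then obtain z where z: "\<And>k i. fst (z k) i \<le> m" "\<And>k i. i \<le> k \<Longrightarrow> tracks i (fst (z k)) (snd (z k))"
      by metis
    have "compactin (product_topology (\<lambda>_::nat. euclidean :: nat topology) UNIV) (Pi\<^sub>E UNIV (\<lambda>_. {..m}))"
      unfolding compactin_PiE by (simp add: compactin_euclidean_iff finite_imp_compact)
    then have "compact (Pi\<^sub>E (UNIV :: nat set) (\<lambda>_. {..m}))"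
      by (simp add: euclidean_product_topology compactin_euclidean_iff)
    then have "seq_compact (Pi\<^sub>E (UNIV :: nat set) (\<lambda>_. {..m}) \<times> (UNIV :: 'a set))"
      by (intro compact_imp_seq_compact compact_Times X)
    moreover have "\<forall>k. z k \<in> Pi\<^sub>E (UNIV :: nat set) (\<lambda>_. {..m}) \<times> (UNIV :: 'a set)"
      using z(1) by (auto simp: mem_Times_iff)
    ultimately obtain l r where l: "l \<in> Pi\<^sub>E (UNIV :: nat set) (\<lambda>_. {..m}) \<times> (UNIV :: 'a set)"
      and r: "strict_mono r" and lim: "(z \<circ> r) \<longlonglongrightarrow> l"
      unfolding seq_compact_def by blast
    obtain p y where py: "l = (p, y)" by (cases l)
    have "(\<lambda>k. fst (z (r k)) i) \<longlonglongrightarrow> p i" for i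
    proof -
      have "continuous_on UNIV (\<lambda>q :: nat \<Rightarrow> nat. q i)"
        by (rule continuous_on_product_then_coordinatewise) (rule continuous_on_id)
      from continuous_on_tendsto_compose[OF this tendsto_fst[OF lim]]
      show ?thesis by (simp add: py)
    qed
    then have gap: "\<forall>\<^sub>F k in sequentially. fst (z (r k)) i = p i" for i
      by (simp add: tendsto_discrete)
    have y: "(\<lambda>k. snd (z (r k))) \<longlonglongrightarrow> y" using tendsto_snd[OF lim] by (simp add: py)
    have "tracks i p y" for i
      unfolding tracks_def
    proof (intro allI impI)
      fix j assume j: "j \<le> n i"
      let ?T = "\<Sum>l<i. n l + p l"
      have "\<forall>\<^sub>F k in sequentially. \<forall>l\<in>{..<i}. fst (z (r k)) l = p l"
        by (intro eventually_ball_finite) (simp_all add: gap)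
      moreover have "\<forall>\<^sub>F k in sequentially. i \<le> k" by (rule eventually_ge_at_top)
      ultimately have "\<forall>\<^sub>F k in sequentially.
          dist ((f ^^ (j + ?T)) (snd (z (r k)))) ((f ^^ j) (x i)) \<le> \<epsilon>"
      proof eventually_elim
        case (elim k)
        have "i \<le> r k" using elim(2) seq_suble[OF r, of k] by simp
        moreover have "(\<Sum>l<i. n l + fst (z (r k)) l) = ?T" using elim(1) by (intro sum.cong) auto
        ultimately show ?case using z(2)[of i "r k"] j by (simp add: tracks_def)
      qed
      moreover have "(\<lambda>k. dist ((f ^^ (j + ?T)) (snd (z (r k)))) ((f ^^ j) (x i)))
          \<longlonglongrightarrow> dist ((f ^^ (j + ?T)) y) ((f ^^ j) (x i))"
        using continuous_on_funpow[OF f, of UNIV "j + ?T"] y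
        by (intro tendsto_dist tendsto_const isCont_tendsto_compose[of y "f ^^ (j + ?T)"])
          (simp_all add: continuous_on_eq_continuous_at)
      ultimately show "dist ((f ^^ (j + ?T)) y) ((f ^^ j) (x i)) \<le> \<epsilon>"
        by (intro tendsto_upperbound) auto
    qed
    moreover have "p i \<le> m" for i using l py by auto
    ultimately show ?thesis unfolding tracks_def by blast
  qed
  then show ?thesis using that by blast
qed

section \<open>Irregular points from interleaved orbits\<close>

text \<open>
  By completeness, divergence is detected at a single scale.
\<close>

lemma not_convergent_far_from_every_limit:
  fixes a :: "nat \<Rightarrow> 'b::banach"
  assumes "\<not> convergent a"
  shows "\<exists>\<eta>>0. \<forall>c. \<not> (\<forall>\<^sub>F k in sequentially. norm (a k - c) \<le> \<eta>)"
proof (rule ccontr)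
  assume "\<not> ?thesis"
  then have *: "\<exists>c. \<forall>\<^sub>F k in sequentially. norm (a k - c) \<le> \<eta>" if "0 < \<eta>" for \<eta>
    using that by blast
  have "Cauchy a"
  proof (rule metric_CauchyI)
    fix e :: real assume "0 < e"
    then obtain c where "\<forall>\<^sub>F k in sequentially. norm (a k - c) \<le> e / 3"
      using *[of "e / 3"] by auto
    then obtain M where M: "\<And>k. M \<le> k \<Longrightarrow> norm (a k - c) \<le> e / 3"
      by (auto simp: eventually_sequentially)
    have "dist (a k) (a l) < e" if "M \<le> k" "M \<le> l" for k l
      using dist_triangle2[of "a k" "a l" c] M[OF that(1)] M[OF that(2)] \<open>0 < e\<close>
      by (simp add: dist_norm)
    then show "\<exists>M. \<forall>k\<ge>M. \<forall>l\<ge>M. dist (a k) (a l) < e" by blast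
  qed
  with assms show False by (simp add: Cauchy_convergent_iff)
qed

lemma sum_pairs: "(\<Sum>l<2 * k. h l) = (\<Sum>i<k. h (2 * i) + h (Suc (2 * i)))"
  for h :: "nat \<Rightarrow> 'b::comm_monoid_add"
  by (induction k) (simp_all add: algebra_simps)

lemma birkhoff_sum_consecutive:
  "(\<Sum>i<k. birkhoff_sum f \<phi> L ((f ^^ (i * L)) x)) = birkhoff_sum f \<phi> (k * L) x"
proof (induction k)
  case 0
  show ?case by (simp add: birkhoff_sum_def)
next
  case (Suc k)
  then show ?case using birkhoff_sum_add[of f \<phi> "k * L" L x] by (simp add: add.commute)
qed

text \<open>
  Even segments follow words \<open>u i\<close> with average close to \<open>a\<close>, odd ones follow consecutive pieces of the orbit
  of \<open>x0\<close>. After \<open>k\<close> periods the Birkhoff sum of \<open>y\<close> is \<open>k n a\<close> plus the sum of \<open>x0\<close> up to time \<open>k L\<close>, with an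
  error proportional to \<open>k\<close>, and the elapsed time is \<open>k (n + L)\<close> up to at most \<open>2 k m\<close>. If the averages of \<open>y\<close>
  converge to \<open>c\<close>, those of \<open>x0\<close> are therefore eventually within \<open>\<eta>\<close> of the point \<open>((n + L) c - n a) / L\<close>.
  This is used to show that \<open>y\<close> is irregular.
\<close>

lemma interleaved_orbit_average:
  fixes \<phi> :: "'a::metric_space \<Rightarrow> 'b::real_normed_vector" and n L :: nat and q :: "nat \<Rightarrow> nat"
  assumes \<kappa>: "\<And>x y. dist x y \<le> \<epsilon> \<Longrightarrow> norm (\<phi> x - \<phi> y) \<le> \<kappa>"
    and \<Phi>: "\<And>x. norm (\<phi> x) \<le> \<Phi>"
    and L: "0 < L" and q: "\<And>i. q i \<le> m"
    and avg: "\<And>i. norm (birkhoff_sum f \<phi> n (u i) - real n *\<^sub>R a) \<le> real n * \<tau>"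
    and shadow: "\<And>i j. j < (if even i then n else L) \<Longrightarrow>
      dist ((f ^^ (j + (\<Sum>l<i. (if even l then n else L) + q l))) y)
        ((f ^^ j) (if even i then u (i div 2) else (f ^^ (i div 2 * L)) x0)) \<le> \<epsilon>"
    and small: "real n * (\<kappa> + \<tau>) + real L * \<kappa> + 4 * real m * \<Phi> < \<eta> * real L"
    and conv: "convergent (\<lambda>N. (1 / real N) *\<^sub>R birkhoff_sum f \<phi> N y)"
  shows "\<exists>c. \<forall>\<^sub>F N in sequentially. norm ((1 / real N) *\<^sub>R birkhoff_sum f \<phi> N x0 - c) \<le> \<eta>"
proof -
  define len where "len i = (if even i then n else L)" for i :: nat
  define T where "T k = (\<Sum>l<2 * k. len l + q l)" for k
  define R where "R = real n * (\<kappa> + \<tau>) + real L * \<kappa> + 2 * real m * \<Phi>"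
  define D where "D = n + L + 2 * m"
  have \<Phi>0: "0 \<le> \<Phi>" using \<Phi>[of undefined] norm_ge_zero order_trans by blast
  have D: "0 < D" using L by (simp add: D_def)
  have gap_sum: "(\<Sum>l<2 * k. q l) \<le> 2 * k * m" for k
    using sum_bounded_above[of "{..<2 * k}" q m] q by simp
  have T_eq: "T k = k * (n + L) + (\<Sum>l<2 * k. q l)" for k
    by (simp add: T_def sum.distrib len_def sum_pairs[of "\<lambda>l. if even l then n else L"])
  have T_lower: "k \<le> T k" for k
    using L by (simp add: T_eq trans_le_add1)
  have T_upper: "T k \<le> k * D" for k
    using gap_sum[of k] by (simp add: T_eq D_def algebra_simps)
  have key: "norm (birkhoff_sum f \<phi> (T k) y - (real k * real n) *\<^sub>R a - birkhoff_sum f \<phi> (k * L) x0) \<le> real k * R" for k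
  proof -
    let ?x = "\<lambda>i. if even i then u (i div 2) else (f ^^ (i div 2 * L)) x0"
    let ?A = "\<Sum>i<k. birkhoff_sum f \<phi> n (u i)"
    have "(\<Sum>i<2 * k. birkhoff_sum f \<phi> (len i) (?x i)) = ?A + birkhoff_sum f \<phi> (k * L) x0"
      by (simp add: sum_pairs sum.distrib len_def birkhoff_sum_consecutive)
    moreover have "norm (birkhoff_sum f \<phi> (T k) y - (\<Sum>i<2 * k. birkhoff_sum f \<phi> (len i) (?x i)))
        \<le> (\<Sum>i<2 * k. real (len i) * \<kappa> + real (q i) * \<Phi>)"
      unfolding T_def using shadow
      by (intro birkhoff_sum_concatenation[where \<epsilon> = \<epsilon>] \<kappa> \<Phi>) (auto simp: len_def)
    moreover have "(\<Sum>i<2 * k. real (len i) * \<kappa> + real (q i) * \<Phi>)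
        \<le> real k * (real n * \<kappa> + real L * \<kappa> + 2 * real m * \<Phi>)"
    proof -
      have "(\<Sum>i<2 * k. real (len i) * \<kappa> + real (q i) * \<Phi>)
          = (\<Sum>i<k. real n * \<kappa> + real L * \<kappa> + (real (q (2 * i)) + real (q (Suc (2 * i)))) * \<Phi>)"
        unfolding sum_pairs len_def by (simp add: distrib_right add.assoc add.left_commute)
      also have "\<dots> \<le> of_nat (card {..<k}) * (real n * \<kappa> + real L * \<kappa> + 2 * real m * \<Phi>)"
      proof (rule sum_bounded_above)
        fix i
        have "real (q (2 * i)) + real (q (Suc (2 * i))) \<le> 2 * real m"
          using q[of "2 * i"] q[of "Suc (2 * i)"] by linarith
        then show "real n * \<kappa> + real L * \<kappa> + (real (q (2 * i)) + real (q (Suc (2 * i)))) * \<Phi>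
            \<le> real n * \<kappa> + real L * \<kappa> + 2 * real m * \<Phi>"
          using \<Phi>0 by (simp add: mult_right_mono)
      qed
      finally show ?thesis by simp
    qed
    moreover have "norm (?A - (real k * real n) *\<^sub>R a) \<le> real k * (real n * \<tau>)"
    proof -
      have "?A - (real k * real n) *\<^sub>R a = (\<Sum>i<k. birkhoff_sum f \<phi> n (u i) - real n *\<^sub>R a)"
        by (simp add: sum_subtractf sum_constant_scaleR)
      then show ?thesis
        using norm_sum[of "\<lambda>i. birkhoff_sum f \<phi> n (u i) - real n *\<^sub>R a" "{..<k}"]
          sum_bounded_above[of "{..<k}" "\<lambda>i. norm (birkhoff_sum f \<phi> n (u i) - real n *\<^sub>R a)" "real n * \<tau>"] avg
        by simp
    qed
    ultimately have "norm ((birkhoff_sum f \<phi> (T k) y - (?A + birkhoff_sum f \<phi> (k * L) x0)) + (?A - (real k * real n) *\<^sub>R a))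
        \<le> real k * (real n * \<kappa> + real L * \<kappa> + 2 * real m * \<Phi>) + real k * (real n * \<tau>)"
      by (intro norm_triangle_mono) simp_all
    then show ?thesis by (simp add: R_def algebra_simps)
  qed
  obtain c where c: "(\<lambda>N. (1 / real N) *\<^sub>R birkhoff_sum f \<phi> N y) \<longlonglongrightarrow> c"
    using conv by (auto simp: convergent_def)
  have "norm c \<le> \<Phi>"
  proof (rule Lim_norm_ubound[OF _ c])
    have "norm ((1 / real N) *\<^sub>R birkhoff_sum f \<phi> N y) \<le> \<Phi>" for N
      using norm_birkhoff_sum_le[of \<phi> \<Phi> f N y, OF \<Phi>] \<Phi>0 by (cases "N = 0") (simp_all add: field_simps)
    then show "\<forall>\<^sub>F N in sequentially. norm ((1 / real N) *\<^sub>R birkhoff_sum f \<phi> N y) \<le> \<Phi>" by simp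
  qed simp
  \<comment> \<open>Half of the slack in the hypothesis on \<open>\<eta>\<close>, distributed over one period.\<close>
  define \<theta> where "\<theta> = (\<eta> * real L - (R + 2 * real m * \<Phi>)) / (2 * real D)"
  have \<theta>: "0 < \<theta>" "R + 2 * real m * \<Phi> + real D * \<theta> < \<eta> * real L"
  proof -
    define Y where "Y = R + 2 * real m * \<Phi>"
    have less: "Y < \<eta> * real L" using small unfolding R_def Y_def by linarith
    then show "0 < \<theta>" using D by (simp add: \<theta>_def Y_def)
    have "real D * \<theta> = (\<eta> * real L - Y) / 2" using D by (simp add: \<theta>_def Y_def)
    then have "Y + real D * \<theta> < \<eta> * real L" using less by (simp only:) (simp add: field_simps)
    then show "R + 2 * real m * \<Phi> + real D * \<theta> < \<eta> * real L" by (simp add: Y_def)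
  qed
  have "\<forall>\<^sub>F N in sequentially. dist ((1 / real N) *\<^sub>R birkhoff_sum f \<phi> N y) c < \<theta>"
    using c \<theta>(1) by (rule tendstoD)
  then obtain N0 where N0: "\<And>N. N0 \<le> N \<Longrightarrow> norm ((1 / real N) *\<^sub>R birkhoff_sum f \<phi> N y - c) < \<theta>"
    by (auto simp: eventually_sequentially dist_norm)
  have tail: "norm (birkhoff_sum f \<phi> N y - real N *\<^sub>R c) \<le> real N * \<theta>" if "N0 \<le> N" "0 < N" for N
  proof -
    have "birkhoff_sum f \<phi> N y - real N *\<^sub>R c = real N *\<^sub>R ((1 / real N) *\<^sub>R birkhoff_sum f \<phi> N y - c)"
      using that by (simp add: scaleR_diff_right)
    then show ?thesis using N0[OF that(1)] by (simp add: mult_left_mono)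
  qed
  define c' where "c' = (1 / real L) *\<^sub>R (real (n + L) *\<^sub>R c - real n *\<^sub>R a)"
  define \<eta>' where "\<eta>' = (R + 2 * real m * \<Phi> + real D * \<theta>) / real L"
  \<comment> \<open>The contribution of an incomplete last piece, negligible for large \<open>N\<close>.\<close>
  define M where "M = real L * \<Phi> + real L * norm c'"
  have \<eta>': "\<eta>' < \<eta>" using \<theta>(2) L by (simp add: \<eta>'_def field_simps)
  have \<eta>'_nonneg: "0 \<le> \<eta>'"
  proof -
    have "0 \<le> \<epsilon>"
      using shadow[of 0 1] L order_trans[OF zero_le_dist] by auto
    then have "0 \<le> \<kappa>" using \<kappa>[of undefined undefined] by simp
    moreover have "0 \<le> real n * \<tau>" using avg order_trans[OF norm_ge_zero] by blast
    ultimately show ?thesis using \<Phi>0 \<theta>(1) by (simp add: \<eta>'_def R_def distrib_left)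
  qed
  have bound: "norm (birkhoff_sum f \<phi> N x0 - real N *\<^sub>R c') \<le> real N * \<eta>' + M"
    if N: "Suc N0 * L \<le> N" for N
  proof -
    define k j where "k = N div L" and "j = N mod L"
    have Nkj: "N = k * L + j" and j: "j < L" using L by (simp_all add: k_def j_def)
    have k: "N0 \<le> k" "0 < k" using div_le_mono[OF N, of L] L by (simp_all add: k_def)
    let ?S = "birkhoff_sum f \<phi>"
    have "norm (?S j ((f ^^ (k * L)) x0)) \<le> real L * \<Phi>"
      using norm_birkhoff_sum_le[of \<phi> \<Phi> f j "(f ^^ (k * L)) x0", OF \<Phi>] j \<Phi>0
        mult_right_mono[of "real j" "real L" \<Phi>] by simp
    moreover have "norm (- (?S (T k) y - (real k * real n) *\<^sub>R a - ?S (k * L) x0)) \<le> real k * R"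
      using key[of k] by (simp only: norm_minus_cancel)
    moreover have "norm (?S (T k) y - real (T k) *\<^sub>R c) \<le> real k * real D * \<theta>"
    proof -
      have "norm (?S (T k) y - real (T k) *\<^sub>R c) \<le> real (T k) * \<theta>"
        using T_lower[of k] k by (intro tail) auto
      moreover have "real (T k) \<le> real k * real D"
        using T_upper[of k] by (metis of_nat_le_iff of_nat_mult)
      then have "real (T k) * \<theta> \<le> real k * real D * \<theta>"
        using \<theta>(1) by (intro mult_right_mono) auto
      ultimately show ?thesis by linarith
    qed
    moreover have "norm ((real (T k) - real (k * (n + L))) *\<^sub>R c) \<le> real k * (2 * real m) * \<Phi>"
    proof -
      have "0 \<le> real (T k) - real (k * (n + L))" "real (T k) - real (k * (n + L)) \<le> real k * (2 * real m)"
        using of_nat_mono[OF gap_sum[of k], where 'a = real] by (simp_all add: T_eq algebra_simps sum_nonneg)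
      then show ?thesis using \<open>norm c \<le> \<Phi>\<close> \<Phi>0 by (simp add: mult_mono)
    qed
    moreover have "norm (- (real j *\<^sub>R c')) \<le> real L * norm c'"
      using j by (simp add: mult_right_mono)
    moreover have "?S N x0 - real N *\<^sub>R c' = ?S j ((f ^^ (k * L)) x0)
        + - (?S (T k) y - (real k * real n) *\<^sub>R a - ?S (k * L) x0)
        + (?S (T k) y - real (T k) *\<^sub>R c) + (real (T k) - real (k * (n + L))) *\<^sub>R c + - (real j *\<^sub>R c')"
    proof -
      have "real (k * L) *\<^sub>R c' = real (k * (n + L)) *\<^sub>R c - (real k * real n) *\<^sub>R a"
        using L by (simp add: c'_def scaleR_diff_right algebra_simps)
      then have "real N *\<^sub>R c' = real (k * (n + L)) *\<^sub>R c - (real k * real n) *\<^sub>R a + real j *\<^sub>R c'"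
        by (simp add: Nkj scaleR_add_left)
      moreover have "?S N x0 = ?S (k * L) x0 + ?S j ((f ^^ (k * L)) x0)"
        unfolding Nkj by (rule birkhoff_sum_add)
      ultimately show ?thesis by (simp add: scaleR_diff_left)
    qed
    ultimately have "norm (?S N x0 - real N *\<^sub>R c') \<le> real L * \<Phi> + real k * R + real k * real D * \<theta>
        + real k * (2 * real m) * \<Phi> + real L * norm c'"
      by (simp only: norm_triangle_mono)
    also have "\<dots> = real k * real L * \<eta>' + M"
      using L by (simp add: \<eta>'_def M_def field_simps)
    also have "\<dots> \<le> real N * \<eta>' + M"
    proof -
      have "real k * real L \<le> real N" by (simp add: Nkj)
      then show ?thesis using \<eta>'_nonneg by (simp add: mult_right_mono)
    qed
    finally show ?thesis .
  qed
  have "\<forall>\<^sub>F N in sequentially. norm ((1 / real N) *\<^sub>R birkhoff_sum f \<phi> N x0 - c') \<le> \<eta>"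
  proof -
    obtain N1 where N1: "M / (\<eta> - \<eta>') \<le> real N1" using real_arch_simple by blast
    show ?thesis
      using eventually_ge_at_top[of "Suc N0 * L + N1 + 1"]
    proof eventually_elim
      case (elim N)
      then have N: "0 < N" "Suc N0 * L \<le> N" "N1 \<le> N" by auto
      have "M \<le> real N1 * (\<eta> - \<eta>')" using N1 \<eta>' by (simp add: field_simps)
      also have "\<dots> \<le> real N * (\<eta> - \<eta>')" using N(3) \<eta>' by (intro mult_right_mono) auto
      finally have "norm (birkhoff_sum f \<phi> N x0 - real N *\<^sub>R c') \<le> real N * \<eta>"
        using bound[OF N(2)] by (simp add: algebra_simps)
      moreover have "(1 / real N) *\<^sub>R birkhoff_sum f \<phi> N x0 - c'
          = (1 / real N) *\<^sub>R (birkhoff_sum f \<phi> N x0 - real N *\<^sub>R c')"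
        using N(1) by (simp add: scaleR_diff_right)
      ultimately show ?case using N(1) by (simp only: norm_scaleR) (simp add: field_simps)
    qed
  qed
  then show ?thesis by blast
qed

section \<open>The pressure of the irregular set at a fixed scale\<close>

lemma finite_centre_cover_bounded:
  fixes r :: real
  assumes "0 < r"
  obtains C :: "'b::euclidean_space set"
  where "finite C" "\<And>x. norm x \<le> R \<Longrightarrow> \<exists>c\<in>C. norm (x - c) \<le> r"
proof -
  have "cball 0 R \<subseteq> (\<Union>c\<in>(UNIV :: 'b set). ball c r)"
    using assms centre_in_ball by blast
  then obtain C :: "'b set" where C: "finite C" "cball 0 R \<subseteq> (\<Union>c\<in>C. ball c r)"
    using compactE_image[OF compact_cball[of 0 R], of UNIV "\<lambda>c. ball c r"] by (metis open_ball)
  have "\<exists>c\<in>C. norm (x - c) \<le> r" if "norm x \<le> R" for x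
    using C(2) that by (force simp: dist_norm norm_minus_commute subset_iff)
  then show ?thesis using that C(1) by blast
qed

lemma exists_heavy_fibre:
  fixes w :: "'a \<Rightarrow> real"
  assumes E: "finite E" "0 < (\<Sum>x\<in>E. w x)" "\<And>x. x \<in> E \<Longrightarrow> 0 \<le> w x"
    and C: "finite C" "\<And>x. x \<in> E \<Longrightarrow> \<exists>c\<in>C. P x c"
  obtains c where "c \<in> C" "(\<Sum>x\<in>E. w x) \<le> real (card C) * (\<Sum>x\<in>{x \<in> E. P x c}. w x)"
proof (rule ccontr)
  assume "\<not> thesis"
  with that have less: "real (card C) * (\<Sum>x\<in>{x \<in> E. P x c}. w x) < (\<Sum>x\<in>E. w x)" if "c \<in> C" for c
    using that by (meson not_le)
  have "E \<noteq> {}" using E(2) by auto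
  then have ne: "C \<noteq> {}" using C(2) by blast
  obtain h where h: "\<And>x. x \<in> E \<Longrightarrow> h x \<in> C \<and> P x (h x)" using C(2) by metis
  have "(\<Sum>x\<in>E. w x) = (\<Sum>c\<in>C. \<Sum>x\<in>{x \<in> E. h x = c}. w x)"
    using h by (intro sum.group[symmetric] E C) auto
  also have "\<dots> \<le> (\<Sum>c\<in>C. \<Sum>x\<in>{x \<in> E. P x c}. w x)"
    using E h by (intro sum_mono sum_mono2) auto
  finally have "(\<Sum>x\<in>E. w x) \<le> (\<Sum>c\<in>C. \<Sum>x\<in>{x \<in> E. P x c}. w x)" .
  then have "real (card C) * (\<Sum>x\<in>E. w x) \<le> real (card C) * (\<Sum>c\<in>C. \<Sum>x\<in>{x \<in> E. P x c}. w x)"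
    by (rule mult_left_mono) simp
  also have "\<dots> = (\<Sum>c\<in>C. real (card C) * (\<Sum>x\<in>{x \<in> E. P x c}. w x))"
    by (rule sum_distrib_left)
  also have "\<dots> < (\<Sum>c\<in>C. \<Sum>x\<in>E. w x)"
    using C(1) ne less by (intro sum_strict_mono) auto
  finally show False by simp
qed

text \<open>
  The bound \<open>\<epsilon>0\<close> depends only on \<open>\<phi>\<close> and \<open>\<delta>\<close>: it makes the variation \<open>\<kappa>\<close> of \<open>\<phi>\<close> small against \<open>\<delta> \<eta>\<close>, where
  \<open>\<eta>\<close> is the scale at which the averages of \<open>x0\<close> diverge. Given \<open>\<epsilon>\<close>, hence the maximal gap \<open>m\<close>, the length
  \<open>n\<close> is chosen so large that \<open>m\<close>, the number of classes in the pigeonhole argument and the factor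
  \<open>g + 1\<close> counting the gap lengths are negligible.
\<close>

lemma pressure_at_irregular_set_ge:
  fixes f :: "'a::metric_space \<Rightarrow> 'a" and \<phi> :: "'a \<Rightarrow> 'b::euclidean_space"
  assumes X: "compact (UNIV :: 'a set)" and f: "continuous_on UNIV f"
    and glue: "gluing_orbit_property f" and \<phi>: "continuous_on UNIV \<phi>"
    and irr: "irregular_set f \<phi> \<noteq> {}" and \<delta>: "0 < \<delta>" "\<delta> \<le> 1"
  obtains \<epsilon>0 where "0 < \<epsilon>0" "\<And>\<epsilon> \<psi> B v t. 0 < \<epsilon> \<Longrightarrow> \<epsilon> \<le> \<epsilon>0 \<Longrightarrow> (\<And>x. \<bar>\<psi> x\<bar> \<le> B) \<Longrightarrow>
    (\<And>x y. dist x y \<le> \<epsilon> \<Longrightarrow> \<bar>\<psi> x - \<psi> y\<bar> \<le> v) \<Longrightarrow>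
    ereal t < limsup (\<lambda>n. ereal (1 / real n * ln (separated_sum f \<psi> n (4 * \<epsilon>)))) \<Longrightarrow>
    ereal ((t - v - \<delta> * B) / (1 + \<delta>)) \<le> pressure_at f (irregular_set f \<phi>) \<psi> \<epsilon>"
proof -
  obtain x0 where "\<not> convergent (\<lambda>N. (1 / real N) *\<^sub>R birkhoff_sum f \<phi> N x0)"
    using irr by (auto simp: irregular_set_def)
  then obtain \<eta> where \<eta>: "0 < \<eta>"
    "\<And>c. \<not> (\<forall>\<^sub>F N in sequentially. norm ((1 / real N) *\<^sub>R birkhoff_sum f \<phi> N x0 - c) \<le> \<eta>)"
    using not_convergent_far_from_every_limit by blast
  obtain \<Phi> where \<Phi>: "\<And>x. norm (\<phi> x) \<le> \<Phi>"
    using compact_imp_bounded[OF compact_continuous_image[OF \<phi> X]] by (auto simp: bounded_iff)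
  have \<Phi>0: "0 \<le> \<Phi>" using \<Phi>[of undefined] norm_ge_zero order_trans by blast
  \<comment> \<open>Since \<open>\<delta> n \<le> L\<close>, the errors \<open>2 n \<kappa>\<close> and \<open>L \<kappa>\<close> add up to at most \<open>3/8\<close> of \<open>\<eta> L\<close>.\<close>
  define \<kappa> where "\<kappa> = \<delta> * \<eta> / 8"
  have \<kappa>0: "0 < \<kappa>" using \<eta> \<delta> by (simp add: \<kappa>_def)
  have "uniformly_continuous_on UNIV \<phi>" using compact_uniformly_continuous[OF \<phi> X] .
  then obtain \<epsilon>1 where \<epsilon>1: "0 < \<epsilon>1" "\<And>x y. dist x y < \<epsilon>1 \<Longrightarrow> dist (\<phi> x) (\<phi> y) < \<kappa>"
    using \<kappa>0 unfolding uniformly_continuous_on_def by (metis UNIV_I dist_commute)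
  obtain C :: "'b set" where C: "finite C" "\<And>x. norm x \<le> \<Phi> \<Longrightarrow> \<exists>c\<in>C. norm (x - c) \<le> \<kappa>"
    using finite_centre_cover_bounded[OF \<kappa>0] by blast
  have C0: "0 < card C" using C(2)[of 0] C(1) \<Phi>0 by (auto simp: card_gt_0_iff)
  have "ereal ((t - v - \<delta> * B) / (1 + \<delta>)) \<le> pressure_at f (irregular_set f \<phi>) \<psi> \<epsilon>"
    if \<epsilon>: "0 < \<epsilon>" "\<epsilon> \<le> \<epsilon>1 / 2" and B: "\<And>x. \<bar>\<psi> x\<bar> \<le> B"
      and v: "\<And>x y. dist x y \<le> \<epsilon> \<Longrightarrow> \<bar>\<psi> x - \<psi> y\<bar> \<le> v"
      and t: "ereal t < limsup (\<lambda>n. ereal (1 / real n * ln (separated_sum f \<psi> n (4 * \<epsilon>))))"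
    for \<epsilon> \<psi> B v t
  proof (rule ccontr)
    assume "\<not> ?thesis"
    then have "pressure_at f (irregular_set f \<phi>) \<psi> \<epsilon> < ereal ((t - v - \<delta> * B) / (1 + \<delta>))" by (simp only: not_le)
    from ereal_dense2[OF this] obtain r where r: "pressure_at f (irregular_set f \<phi>) \<psi> \<epsilon> < ereal r"
      "r < (t - v - \<delta> * B) / (1 + \<delta>)" by auto
    have B0: "0 \<le> B" using B[of undefined] by linarith
    have mod\<phi>: "norm (\<phi> x - \<phi> y) \<le> \<kappa>" if "dist x y \<le> \<epsilon>" for x y
      using \<epsilon>1(2)[of x y] that \<epsilon> \<epsilon>1(1) by (simp add: dist_norm)
    obtain m where m: "\<And>(x :: nat \<Rightarrow> 'a) (n :: nat \<Rightarrow> nat). \<forall>i. 1 \<le> n i \<Longrightarrow>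
        \<exists>(p :: nat \<Rightarrow> nat) y. (\<forall>i. p i \<le> m) \<and>
          (\<forall>i. \<forall>j\<le>n i. dist ((f ^^ (j + (\<Sum>l<i. n l + p l))) y) ((f ^^ j) (x i)) \<le> \<epsilon>)"
      using gluing_orbit_property_infinite[OF X f glue \<epsilon>(1)] by blast
    define a where "a = t - v - \<delta> * B - r * (1 + \<delta>)"
    have a: "0 < a" using r(2) \<delta> by (simp add: a_def field_simps)
    \<comment> \<open>A slope for the tangent bound \<open>ln x \<le> b x - 1 - ln b\<close> that consumes half of the gain \<open>a n\<close>.\<close>
    define b where "b = a / (2 * \<delta>)"
    have b: "0 < b" using a \<delta> by (simp add: b_def)
    define M where "M = 2 * real m + 2"
    define const where "const = ln (real (card C)) + (b * M - 1 - ln b) + M * (\<bar>r\<bar> + B)"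
    have freq: "\<exists>\<^sub>F n in sequentially. ereal t < ereal (1 / real n * ln (separated_sum f \<psi> n (4 * \<epsilon>)))"
    proof (rule ccontr)
      assume "\<not> ?thesis"
      then have "\<forall>\<^sub>F n in sequentially. ereal (1 / real n * ln (separated_sum f \<psi> n (4 * \<epsilon>))) \<le> ereal t"
        by (simp add: not_frequently not_less)
      then have "limsup (\<lambda>n. ereal (1 / real n * ln (separated_sum f \<psi> n (4 * \<epsilon>)))) \<le> ereal t"
        by (rule Limsup_bounded)
      with t show False by simp
    qed
    obtain N1 :: nat where N1: "16 * real m * \<Phi> / (\<eta> * \<delta>) < real N1" using reals_Archimedean2 by blast
    obtain N2 :: nat where N2: "2 * const / a < real N2" using reals_Archimedean2 by blast
    have "\<forall>\<^sub>F n in sequentially. N1 \<le> n \<and> N2 \<le> n \<and> 0 < n"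
      by (intro eventually_conj eventually_ge_at_top eventually_gt_at_top)
    from frequently_ex[OF frequently_eventually_frequently[OF freq this]]
    obtain n where n: "t < 1 / real n * ln (separated_sum f \<psi> n (4 * \<epsilon>))" "N1 \<le> n" "N2 \<le> n" "0 < n"
      by auto
    define L where "L = nat \<lceil>\<delta> * real n\<rceil>"
    \<comment> \<open>For the words from \<open>E\<close> the inserted piece and its two gaps together form one gap.\<close>
    define g where "g = L + 2 * m"
    have L: "\<delta> * real n \<le> real L" "real L \<le> \<delta> * real n + 1" "0 < L"
    proof -
      have "0 < \<delta> * real n" using \<delta> n by simp
      then show "\<delta> * real n \<le> real L" "real L \<le> \<delta> * real n + 1" "0 < L"
        by (simp_all add: L_def of_nat_ceiling)
    qed
    have small: "real n * (\<kappa> + \<kappa>) + real L * \<kappa> + 4 * real m * \<Phi> < \<eta> * real L"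
    proof -
      have "16 * real m * \<Phi> < \<eta> * (\<delta> * real n)"
      proof -
        have "16 * real m * \<Phi> / (\<eta> * \<delta>) < real n" using N1 n(2) by simp
        then show ?thesis using \<eta>(1) \<delta>(1) by (simp add: field_simps)
      qed
      moreover have "\<eta> * (\<delta> * real n) \<le> \<eta> * real L" using L(1) \<eta>(1) by (intro mult_left_mono) auto
      moreover have "real n * (\<kappa> + \<kappa>) = \<eta> * (\<delta> * real n) / 4" by (simp add: \<kappa>_def)
      moreover have "real L * \<kappa> \<le> \<eta> * real L / 8"
        using \<delta> \<eta>(1) mult_left_mono[of \<delta> 1 "\<eta> * real L"] by (simp add: \<kappa>_def mult_ac)
      moreover have "0 < \<eta> * real L" using L(3) \<eta>(1) by simp
      ultimately show ?thesis by linarith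
    qed
    have "exp (real n * t) < separated_sum f \<psi> n (4 * \<epsilon>)"
    proof -
      have "real n * t < ln (separated_sum f \<psi> n (4 * \<epsilon>))" using n(1,4) by (simp add: field_simps)
      then show ?thesis
        using separated_sum_pos[where \<psi> = \<psi>, OF X f B n(4), of "4 * \<epsilon>"] \<epsilon>(1)
          exp_less_cancel_iff[of "real n * t" "ln (separated_sum f \<psi> n (4 * \<epsilon>))"] by simp
    qed
    then obtain E where E: "separated f n (4 * \<epsilon>) E" "finite E"
      "exp (real n * t) < (\<Sum>x\<in>E. exp (birkhoff_sum f \<psi> n x))"
      using less_separated_sumD[where \<psi> = \<psi>, OF X f B n(4), of "4 * \<epsilon>"] \<epsilon>(1) by auto
    obtain c where c: "(\<Sum>x\<in>E. exp (birkhoff_sum f \<psi> n x))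
      \<le> real (card C) * (\<Sum>x\<in>{x \<in> E. norm (birkhoff_sum f \<phi> n x - real n *\<^sub>R c) \<le> real n * \<kappa>}. exp (birkhoff_sum f \<psi> n x))"
    proof (rule exists_heavy_fibre[where E = E and C = C
          and P = "\<lambda>x c. norm (birkhoff_sum f \<phi> n x - real n *\<^sub>R c) \<le> real n * \<kappa>"])
      show "0 < (\<Sum>x\<in>E. exp (birkhoff_sum f \<psi> n x))" using E(3) less_trans[OF exp_gt_zero] by blast
      fix x
      have "norm ((1 / real n) *\<^sub>R birkhoff_sum f \<phi> n x) \<le> \<Phi>"
        using norm_birkhoff_sum_le[of \<phi> \<Phi> f n x, OF \<Phi>] n(4) by (simp add: field_simps)
      then obtain c where "c \<in> C" "norm ((1 / real n) *\<^sub>R birkhoff_sum f \<phi> n x - c) \<le> \<kappa>" using C(2) by blast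
      moreover have "birkhoff_sum f \<phi> n x - real n *\<^sub>R c = real n *\<^sub>R ((1 / real n) *\<^sub>R birkhoff_sum f \<phi> n x - c)"
        using n(4) by (simp add: scaleR_diff_right)
      ultimately show "\<exists>c\<in>C. norm (birkhoff_sum f \<phi> n x - real n *\<^sub>R c) \<le> real n * \<kappa>"
        by (metis abs_of_nat mult_left_mono norm_scaleR of_nat_0_le_iff)
    qed (use E C in auto)
    define E' where "E' = {x \<in> E. norm (birkhoff_sum f \<phi> n x - real n *\<^sub>R c) \<le> real n * \<kappa>}"
    define W where "W = (\<Sum>x\<in>E'. exp (birkhoff_sum f \<psi> n x))"
    have W: "exp (real n * t) < real (card C) * W" using E(3) c unfolding W_def E'_def by linarith
    have W0: "0 < W"
      using less_trans[OF exp_gt_zero W] C0 by (simp add: zero_less_mult_iff)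
    have "E' \<noteq> {}" using W0 by (auto simp: W_def)
    have concat: "\<exists>y\<in>irregular_set f \<phi>. \<exists>p. (\<forall>i. p i \<le> g) \<and>
      (\<forall>i. \<forall>j<n. dist ((f ^^ (j + (\<Sum>l<i. n + p l))) y) ((f ^^ j) (\<omega> i)) \<le> \<epsilon>)"
      if \<omega>: "\<forall>i. \<omega> i \<in> E'" for \<omega> :: "nat \<Rightarrow> 'a"
    proof -
      let ?x = "\<lambda>i. if even i then \<omega> (i div 2) else (f ^^ (i div 2 * L)) x0"
      let ?n = "\<lambda>i::nat. if even i then n else L"
      have "\<forall>i. 1 \<le> ?n i" using n(4) L(3) by auto
      from m[OF this, of ?x] obtain q y where "\<forall>i. q i \<le> m"
        and "\<forall>i. \<forall>j\<le>?n i. dist ((f ^^ (j + (\<Sum>l<i. ?n l + q l))) y) ((f ^^ j) (?x i)) \<le> \<epsilon>"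
        by (elim exE conjE)
      then have q: "\<And>i. q i \<le> m"
        and y: "\<And>i j. j \<le> ?n i \<Longrightarrow> dist ((f ^^ (j + (\<Sum>l<i. ?n l + q l))) y) ((f ^^ j) (?x i)) \<le> \<epsilon>"
        by blast+
      have "y \<in> irregular_set f \<phi>"
      proof (rule ccontr)
        assume "y \<notin> irregular_set f \<phi>"
        then have conv: "convergent (\<lambda>N. (1 / real N) *\<^sub>R birkhoff_sum f \<phi> N y)"
          by (simp add: irregular_set_def)
        have avg: "norm (birkhoff_sum f \<phi> n (\<omega> i) - real n *\<^sub>R c) \<le> real n * \<kappa>" for i
          using \<omega> by (simp add: E'_def)
        show False
          using interleaved_orbit_average[where u = \<omega> and q = q and y = y, OF mod\<phi> \<Phi> L(3) q avg _ small conv] y \<eta>(2)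
          by (meson less_imp_le)
      qed
      moreover have "\<exists>p. (\<forall>i. p i \<le> g) \<and>
        (\<forall>i. \<forall>j<n. dist ((f ^^ (j + (\<Sum>l<i. n + p l))) y) ((f ^^ j) (\<omega> i)) \<le> \<epsilon>)"
      proof (intro exI conjI allI impI)
        let ?p = "\<lambda>i. q (2 * i) + L + q (Suc (2 * i))"
        show "?p i \<le> g" for i using q[of "2 * i"] q[of "Suc (2 * i)"] by (simp add: g_def)
        fix i j assume "j < n"
        moreover have "(\<Sum>l<2 * i. ?n l + q l) = (\<Sum>l<i. n + ?p l)"
          unfolding sum_pairs by (intro sum.cong) auto
        ultimately show "dist ((f ^^ (j + (\<Sum>l<i. n + ?p l))) y) ((f ^^ j) (\<omega> i)) \<le> \<epsilon>"
          using y[of j "2 * i"] by simp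
      qed
      ultimately show ?thesis by blast
    qed
    have E'_sep: "finite E'" "separated f n (4 * \<epsilon>) E'"
      using E separated_subset[OF E(1), of E'] by (auto simp: E'_def)
    have "ereal ((ln W - ln (real g + 1) - real n * v - real g * B) / real (n + g))
        \<le> pressure_at f (irregular_set f \<phi>) \<psi> \<epsilon>"
      unfolding W_def
      by (rule pressure_at_ge_of_concatenations)
        (fact B v n(4) E'_sep \<open>E' \<noteq> {}\<close> concat)+
    moreover have "r \<le> (ln W - ln (real g + 1) - real n * v - real g * B) / real (n + g)"
    proof -
      have g: "\<delta> * real n \<le> real g" "real g + 1 \<le> \<delta> * real n + M"
        using L by (simp_all add: g_def M_def)
      have M: "0 \<le> M" by (simp add: M_def)
      have "real n * t < ln (real (card C) * W)"
        using W W0 C0 by (metis exp_gt_zero ln_exp ln_less_cancel_iff mult_pos_pos of_nat_0_less_iff)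
      then have "real n * t < ln (real (card C)) + ln W"
        using W0 C0 by (simp add: ln_mult)
      moreover have "ln (real g + 1) \<le> b * (\<delta> * real n + M) - 1 - ln b"
      proof -
        have "ln (real g + 1) \<le> ln (\<delta> * real n + M)" using g(2) by (intro ln_mono) auto
        moreover have "ln (b * (\<delta> * real n + M)) \<le> b * (\<delta> * real n + M) - 1"
          using b g by (intro ln_le_minus_one mult_pos_pos) auto
        moreover have "ln (b * (\<delta> * real n + M)) = ln b + ln (\<delta> * real n + M)"
          using b g by (intro ln_mult_pos) auto
        ultimately show ?thesis by linarith
      qed
      moreover have "b * (\<delta> * real n + M) = a * real n / 2 + b * M"
        using \<delta> by (simp add: b_def field_simps)
      moreover have "real g * B \<le> (\<delta> * real n + M) * B" using g B0 by (intro mult_right_mono) auto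
      moreover have "r * real g \<le> r * (\<delta> * real n) + \<bar>r\<bar> * M"
      proof -
        have "r * (real g - \<delta> * real n) \<le> \<bar>r\<bar> * (real g - \<delta> * real n)"
          using g by (intro mult_right_mono) auto
        also have "\<dots> \<le> \<bar>r\<bar> * M" using g by (intro mult_left_mono) auto
        finally show ?thesis by (simp add: algebra_simps)
      qed
      moreover have "const \<le> a * real n / 2"
      proof -
        have "2 * const / a < real n" using N2 n(3) by simp
        then show ?thesis using a by (simp add: field_simps)
      qed
      moreover have "a * real n = real n * t - real n * v - (\<delta> * real n) * B - r * real n - r * (\<delta> * real n)"
        by (simp add: a_def algebra_simps)
      moreover have "const = ln (real (card C)) + b * M - 1 - ln b + \<bar>r\<bar> * M + M * B"
        by (simp add: const_def algebra_simps)
      ultimately have "r * real n + r * real g \<le> ln W - ln (real g + 1) - real n * v - real g * B"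
        unfolding distrib_right by linarith
      then show ?thesis using n(4) by (simp add: field_simps)
    qed
    ultimately have "ereal r \<le> pressure_at f (irregular_set f \<phi>) \<psi> \<epsilon>"
      by (meson ereal_less_eq(3) order_trans)
    with r(1) show False by simp
  qed
  then show ?thesis using that[of "\<epsilon>1 / 2"] \<epsilon>1(1) by auto
qed

section \<open>Passing to the limit\<close>

text \<open>
  Rescaling \<open>\<epsilon>\<close> by a constant changes \<open>- ln \<epsilon>\<close> only by a bounded amount, so the quotients are compared up to
  factors arbitrarily close to \<open>1\<close>.
\<close>

lemma limits_over_minus_ln_le:
  fixes F G :: "real \<Rightarrow> ereal"
  assumes c: "0 < c"
    and le: "\<And>\<delta>. 0 < \<delta> \<Longrightarrow> \<delta> \<le> 1 \<Longrightarrow> \<forall>\<^sub>F \<epsilon> in at_right 0. F (c * \<epsilon>) \<le> ereal (1 + \<delta>) * G \<epsilon>"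
    and nonneg: "\<forall>\<^sub>F \<epsilon> in at_right 0. 0 \<le> G \<epsilon>"
  shows "Liminf (at_right 0) (\<lambda>\<epsilon>. F \<epsilon> / ereal (- ln \<epsilon>)) \<le> Liminf (at_right 0) (\<lambda>\<epsilon>. G \<epsilon> / ereal (- ln \<epsilon>))"
    (is "Liminf _ ?F \<le> Liminf _ ?G")
    and "Limsup (at_right 0) (\<lambda>\<epsilon>. F \<epsilon> / ereal (- ln \<epsilon>)) \<le> Limsup (at_right 0) (\<lambda>\<epsilon>. G \<epsilon> / ereal (- ln \<epsilon>))"
proof -
  have small: "\<forall>\<^sub>F \<epsilon> in at_right 0. ln \<epsilon> \<le> z" for z :: real
    using ln_at_0 by (simp add: filterlim_at_bot)
  have pos: "\<forall>\<^sub>F \<epsilon> in at_right 0. (0::real) < \<epsilon>" by (rule eventually_at_right_less)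
  have quot: "\<forall>\<^sub>F \<epsilon> in at_right 0. ?F (c * \<epsilon>) \<le> ereal ((1 + \<delta>)\<^sup>2) * ?G \<epsilon>"
    if \<delta>: "0 < \<delta>" "\<delta> \<le> 1" for \<delta>
    using le[OF \<delta>] nonneg pos small[of "- 1"] small[of "- ln c - 1"] small[of "- ((1 + \<delta>) * ln c / \<delta>)"]
  proof eventually_elim
    case (elim \<epsilon>)
    define x z where "x = - ln (c * \<epsilon>)" and "z = - ln \<epsilon>"
    have ln: "ln (c * \<epsilon>) = ln c + ln \<epsilon>" using c elim(3) by (simp add: ln_mult)
    have x: "0 < x" using elim(5) by (simp add: x_def ln)
    have z: "0 < z" using elim(4) by (simp add: z_def)
    have "\<delta> * ln \<epsilon> + (1 + \<delta>) * ln c \<le> 0" using elim(6) \<delta> by (simp add: field_simps)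
    then have "z \<le> (1 + \<delta>) * x" unfolding x_def z_def ln by (simp add: algebra_simps)
    then have xz: "1 / x \<le> (1 + \<delta>) / z" using x z by (simp add: field_simps)
    have "F (c * \<epsilon>) * ereal (1 / x) \<le> (ereal (1 + \<delta>) * G \<epsilon>) * ereal (1 / x)"
      using elim(1) x by (intro ereal_mult_right_mono) auto
    also have "\<dots> \<le> (ereal (1 + \<delta>) * G \<epsilon>) * ereal ((1 + \<delta>) / z)"
      using elim(2) xz \<delta> by (intro ereal_mult_left_mono) auto
    also have "\<dots> = ereal ((1 + \<delta>)\<^sup>2) * (G \<epsilon> * ereal (1 / z))"
      using \<delta> z by (cases "G \<epsilon>") (auto simp: power2_eq_square)
    finally show ?case using x z by (simp add: divide_ereal_def x_def z_def inverse_eq_divide)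
  qed
  have scale: "filtermap ((*) c) (at_right 0) = at_right 0" and inj: "inj ((*) c)"
    using filtermap_times_pos_at_right[OF c, of 0] c by (auto simp: inj_on_def)
  have "\<forall>\<^sub>F \<epsilon> in at_right 0. 0 \<le> ?G \<epsilon>"
    using nonneg small[of "- 1"]
    by eventually_elim (simp add: divide_ereal_def)
  then have nonnegG: "0 \<le> Liminf (at_right 0) ?G" "0 \<le> Limsup (at_right 0) ?G"
    by (auto intro!: Liminf_bounded le_Limsup)
  have limit: "A \<le> D" if AD: "\<And>\<delta>. 0 < \<delta> \<Longrightarrow> \<delta> \<le> 1 \<Longrightarrow> A \<le> ereal ((1 + \<delta>)\<^sup>2) * D" for A D :: ereal
  proof (rule tendsto_lowerbound)
    have "((\<lambda>\<delta>. ereal ((1 + \<delta>)\<^sup>2)) \<longlongrightarrow> ereal ((1 + 0)\<^sup>2)) (at_right 0)"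
      by (intro tendsto_intros)
    then show "((\<lambda>\<delta>. ereal ((1 + \<delta>)\<^sup>2) * D) \<longlongrightarrow> D) (at_right 0)"
      using tendsto_mult_ereal[OF _ tendsto_const, of "\<lambda>\<delta>. ereal ((1 + \<delta>)\<^sup>2)" 1 "at_right 0" D]
      by (simp add: one_ereal_def)
    show "\<forall>\<^sub>F \<delta> in at_right 0. A \<le> ereal ((1 + \<delta>)\<^sup>2) * D"
      using eventually_at_right_real[of 0 1] by (rule eventually_mono) (auto intro: AD)
  qed simp
  show "Liminf (at_right 0) ?F \<le> Liminf (at_right 0) ?G"
  proof (rule limit)
    fix \<delta> :: real assume \<delta>: "0 < \<delta>" "\<delta> \<le> 1"
    have "Liminf (at_right 0) ?F = Liminf (at_right 0) (\<lambda>\<epsilon>. ?F (c * \<epsilon>))"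
      using Liminf_filtermap_eq[OF inj, of "at_right 0" ?F] by (simp only: scale)
    also have "\<dots> \<le> Liminf (at_right 0) (\<lambda>\<epsilon>. ereal ((1 + \<delta>)\<^sup>2) * ?G \<epsilon>)"
      by (rule Liminf_mono) (rule quot[OF \<delta>])
    also have "\<dots> = ereal ((1 + \<delta>)\<^sup>2) * Liminf (at_right 0) ?G"
      by (rule Liminf_ereal_mult_left) auto
    finally show "Liminf (at_right 0) ?F \<le> ereal ((1 + \<delta>)\<^sup>2) * Liminf (at_right 0) ?G" .
  qed
  show "Limsup (at_right 0) ?F \<le> Limsup (at_right 0) ?G"
  proof (rule limit)
    fix \<delta> :: real assume \<delta>: "0 < \<delta>" "\<delta> \<le> 1"
    have "Limsup (at_right 0) ?F = Limsup (at_right 0) (\<lambda>\<epsilon>. ?F (c * \<epsilon>))"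
      using Limsup_filtermap_eq[OF inj, of "at_right 0" ?F] by (simp only: scale)
    also have "\<dots> \<le> Limsup (at_right 0) (\<lambda>\<epsilon>. ereal ((1 + \<delta>)\<^sup>2) * ?G \<epsilon>)"
      by (rule Limsup_mono) (rule quot[OF \<delta>])
    also have "\<dots> = ereal ((1 + \<delta>)\<^sup>2) * Limsup (at_right 0) ?G"
      by (rule Limsup_ereal_mult_left) auto
    finally show "Limsup (at_right 0) ?F \<le> ereal ((1 + \<delta>)\<^sup>2) * Limsup (at_right 0) ?G" .
  qed
qed

text \<open>
  The pressure of a set at scale \<open>\<epsilon>\<close> need not be monotone in \<open>\<epsilon>\<close>, but the separated growth rate is, and
  the former is squeezed between the values of the latter at \<open>4\<epsilon>\<close> and \<open>\<epsilon>/2\<close>. Working with arbitrary bounds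
  below and above the limit \<open>P\<close> covers the case \<open>P = \<infinity>\<close> as well.
\<close>

lemma irregular_set_carries_full_pressure:
  fixes f :: "'a::metric_space \<Rightarrow> 'a" and \<phi> :: "'a \<Rightarrow> 'b::euclidean_space"
  assumes X: "compact (UNIV :: 'a set)" and f: "continuous_on UNIV f"
    and glue: "gluing_orbit_property f" and \<phi>: "continuous_on UNIV \<phi>"
    and irr: "irregular_set f \<phi> \<noteq> {}"
  shows "carries_full_pressure f (irregular_set f \<phi>)"
  unfolding carries_full_pressure_def
proof (intro allI impI)
  fix \<psi> :: "'a \<Rightarrow> real" assume \<psi>: "continuous_on UNIV \<psi>"
  obtain B where B: "\<And>x. \<bar>\<psi> x\<bar> \<le> B"
    using compact_imp_bounded[OF compact_continuous_image[OF \<psi> X]] by (auto simp: bounded_iff)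
  have modulus: "\<exists>\<epsilon>1>0. \<forall>x y. dist x y \<le> \<epsilon>1 \<longrightarrow> \<bar>\<psi> x - \<psi> y\<bar> \<le> v" if v: "0 < v" for v
  proof -
    have "uniformly_continuous_on UNIV \<psi>" using compact_uniformly_continuous[OF \<psi> X] .
    then obtain d where d: "0 < d" "\<And>x y. dist x y < d \<Longrightarrow> dist (\<psi> x) (\<psi> y) < v"
      using v unfolding uniformly_continuous_on_def by (metis UNIV_I dist_commute)
    have "\<bar>\<psi> x - \<psi> y\<bar> \<le> v" if "dist x y \<le> d / 2" for x y
      using d(2)[of x y] that d(1) by (simp add: dist_real_def)
    then show ?thesis using d(1) by (intro exI[of _ "d / 2"]) auto
  qed
  let ?Z = "irregular_set f \<phi>"
  define rate where "rate \<epsilon> = limsup (\<lambda>n. ereal (1 / real n * ln (separated_sum f \<psi> n \<epsilon>)))" for \<epsilon>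
  define P where "P = (SUP \<epsilon>\<in>{0<..}. rate \<epsilon>)"
  have anti: "rate \<epsilon> \<le> rate \<epsilon>'" if "0 < \<epsilon>'" "\<epsilon>' \<le> \<epsilon>" for \<epsilon> \<epsilon>'
    unfolding rate_def
  proof (rule Limsup_mono, rule eventually_mono[OF eventually_gt_at_top[of 0]])
    fix n :: nat assume "0 < n"
    then show "ereal (1 / real n * ln (separated_sum f \<psi> n \<epsilon>)) \<le> ereal (1 / real n * ln (separated_sum f \<psi> n \<epsilon>'))"
      using that separated_sum_antimono[where \<psi> = \<psi>, OF X f B, of n \<epsilon>' \<epsilon>]
        separated_sum_pos[where \<psi> = \<psi>, OF X f B, of n \<epsilon>]
      by (simp add: divide_right_mono)
  qed
  have le_P: "rate \<epsilon> \<le> P" if "0 < \<epsilon>" for \<epsilon>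
    unfolding P_def using that by (intro SUP_upper) auto
  have pos: "\<forall>\<^sub>F \<epsilon> in at_right 0. (0::real) < \<epsilon>" by (rule eventually_at_right_less)
  have rate_gt: "\<forall>\<^sub>F \<epsilon> in at_right 0. a < rate (c * \<epsilon>)" if "a < P" "0 < c" for a c
  proof -
    obtain \<epsilon>1 where \<epsilon>1: "0 < \<epsilon>1" "a < rate \<epsilon>1" using \<open>a < P\<close> by (auto simp: P_def less_SUP_iff)
    have "\<forall>\<^sub>F \<epsilon> in at_right 0. \<epsilon> \<in> {0<..<\<epsilon>1 / c}" using \<epsilon>1 that by (intro eventually_at_right_real) auto
    then show ?thesis
    proof eventually_elim
      case (elim \<epsilon>)
      then have "c * \<epsilon> \<le> \<epsilon>1" "0 < c * \<epsilon>" using that by (auto simp: field_simps)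
      then show ?case using anti[of "c * \<epsilon>" \<epsilon>1] \<epsilon>1(2) by (meson less_le_trans)
    qed
  qed
  have "(rate \<longlongrightarrow> P) (at_right 0)"
  proof (rule order_tendstoI)
    show "\<forall>\<^sub>F \<epsilon> in at_right 0. a < rate \<epsilon>" if "a < P" for a
      using rate_gt[OF that, of 1] by simp
    show "\<forall>\<^sub>F \<epsilon> in at_right 0. rate \<epsilon> < a" if "P < a" for a
      using pos by eventually_elim (use le_P that in \<open>blast intro: le_less_trans\<close>)
  qed
  then have top: "top_pressure f \<psi> = P"
    unfolding top_pressure_def separated_sum_def[symmetric] rate_def
    by (intro tendsto_Lim) auto
  have "((\<lambda>\<epsilon>. pressure_at f ?Z \<psi> \<epsilon>) \<longlongrightarrow> P) (at_right 0)"
  proof (rule order_tendstoI)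
    fix a assume "P < a"
    have "\<exists>v>0. P + ereal v < a"
    proof -
      obtain b where b: "P < ereal b" "ereal b < a" using ereal_dense2[OF \<open>P < a\<close>] by blast
      show ?thesis
      proof (cases P)
        case (real r)
        then show ?thesis using b by (intro exI[of _ "b - r"]) simp
      qed (use b in \<open>auto intro!: exI[of _ 1]\<close>)
    qed
    then obtain v where v: "0 < v" "P + ereal v < a" by blast
    obtain \<epsilon>1 where \<epsilon>1: "0 < \<epsilon>1" "\<And>x y. dist x y \<le> \<epsilon>1 \<Longrightarrow> \<bar>\<psi> x - \<psi> y\<bar> \<le> v"
      using modulus[OF v(1)] by blast
    have "\<forall>\<^sub>F \<epsilon> in at_right 0. \<epsilon> \<in> {0<..<\<epsilon>1}" using \<epsilon>1 by (intro eventually_at_right_real) auto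
    then show "\<forall>\<^sub>F \<epsilon> in at_right 0. pressure_at f ?Z \<psi> \<epsilon> < a"
    proof eventually_elim
      case (elim \<epsilon>)
      have "pressure_at f ?Z \<psi> \<epsilon>
          \<le> liminf (\<lambda>n. ereal (1 / real n * ln (separated_sum f \<psi> n (\<epsilon> / 2)))) + ereal v"
        using elim \<epsilon>1(2) by (intro pressure_at_leI[OF X f B]) auto
      also have "\<dots> \<le> rate (\<epsilon> / 2) + ereal v"
        unfolding rate_def by (intro add_right_mono Liminf_le_Limsup) simp
      also have "\<dots> \<le> P + ereal v" using elim by (intro add_right_mono le_P) auto
      finally show ?case using v(2) by (rule le_less_trans)
    qed
  next
    fix a assume "a < P"
    obtain b where b: "a < ereal b" "ereal b < P" using ereal_dense2[OF \<open>a < P\<close>] by blast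
    obtain t where t: "ereal b < ereal t" "ereal t < P" using ereal_dense2[OF b(2)] by blast
    \<comment> \<open>The same small number serves as the fraction of inserted time and as the variation of \<open>\<psi>\<close>.\<close>
    have "((\<lambda>\<delta>. (t - \<delta> - \<delta> * B) / (1 + \<delta>)) \<longlongrightarrow> (t - 0 - 0 * B) / (1 + 0)) (at_right 0)"
      by (intro tendsto_intros) auto
    then have "\<forall>\<^sub>F \<delta> in at_right 0. b < (t - \<delta> - \<delta> * B) / (1 + \<delta>)"
      using t(1) by (intro order_tendstoD(1)) auto
    moreover have "\<forall>\<^sub>F \<delta> in at_right 0. \<delta> \<in> {0<..<1::real}" by (rule eventually_at_right_real) simp
    ultimately have "\<forall>\<^sub>F \<delta> in at_right 0. b < (t - \<delta> - \<delta> * B) / (1 + \<delta>) \<and> \<delta> \<in> {0<..<1}"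
      by (rule eventually_conj)
    then obtain \<delta> where \<delta>: "b < (t - \<delta> - \<delta> * B) / (1 + \<delta>)" "0 < \<delta>" "\<delta> \<le> 1"
      using eventually_happens'[OF trivial_limit_at_right_real] by force
    obtain \<epsilon>1 where \<epsilon>1: "0 < \<epsilon>1" "\<And>x y. dist x y \<le> \<epsilon>1 \<Longrightarrow> \<bar>\<psi> x - \<psi> y\<bar> \<le> \<delta>"
      using modulus[OF \<delta>(2)] by blast
    obtain \<epsilon>0 where \<epsilon>0: "0 < \<epsilon>0" "\<And>\<epsilon> \<psi> B v t. 0 < \<epsilon> \<Longrightarrow> \<epsilon> \<le> \<epsilon>0 \<Longrightarrow> (\<And>x. \<bar>\<psi> x\<bar> \<le> B) \<Longrightarrow>
        (\<And>x y. dist x y \<le> \<epsilon> \<Longrightarrow> \<bar>\<psi> x - \<psi> y\<bar> \<le> v) \<Longrightarrow>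
        ereal t < limsup (\<lambda>n. ereal (1 / real n * ln (separated_sum f \<psi> n (4 * \<epsilon>)))) \<Longrightarrow>
        ereal ((t - v - \<delta> * B) / (1 + \<delta>)) \<le> pressure_at f ?Z \<psi> \<epsilon>"
      using pressure_at_irregular_set_ge[OF X f glue \<phi> irr \<delta>(2,3)] by blast
    have "\<forall>\<^sub>F \<epsilon> in at_right 0. \<epsilon> \<in> {0<..<min \<epsilon>0 \<epsilon>1}"
      using \<epsilon>0(1) \<epsilon>1(1) by (intro eventually_at_right_real) auto
    moreover have "\<forall>\<^sub>F \<epsilon> in at_right 0. ereal t < rate (4 * \<epsilon>)" using rate_gt[OF t(2)] by simp
    ultimately show "\<forall>\<^sub>F \<epsilon> in at_right 0. a < pressure_at f ?Z \<psi> \<epsilon>"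
    proof eventually_elim
      case (elim \<epsilon>)
      have "a < ereal ((t - \<delta> - \<delta> * B) / (1 + \<delta>))" using b(1) \<delta>(1) by (meson less_ereal.simps(1) less_trans)
      also have "\<dots> \<le> pressure_at f ?Z \<psi> \<epsilon>"
        using elim B \<epsilon>1(2) unfolding rate_def by (intro \<epsilon>0(2)) auto
      finally show ?case .
    qed
  qed
  then have "rel_pressure f ?Z \<psi> = P"
    unfolding rel_pressure_def by (intro tendsto_Lim) auto
  with top show "rel_pressure f ?Z \<psi> = top_pressure f \<psi>" by simp
qed

text \<open>
  With \<open>lo\<close> and \<open>up\<close> the lower and upper growth rates of separated sets and \<open>h\<close> the entropy of the irregular set
  at scale \<open>\<epsilon>\<close>, the two bounds on pressure read \<open>h (2\<epsilon>) \<le> lo \<epsilon>\<close> and \<open>up (4\<epsilon>) \<le> (1 + \<delta>) h \<epsilon>\<close>. As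
  \<open>lo \<le> up\<close>, this settles both metric mean dimensions.
\<close>

lemma irregular_set_carries_full_mdim:
  fixes f :: "'a::metric_space \<Rightarrow> 'a" and \<phi> :: "'a \<Rightarrow> 'b::euclidean_space"
  assumes X: "compact (UNIV :: 'a set)" and f: "continuous_on UNIV f"
    and glue: "gluing_orbit_property f" and \<phi>: "continuous_on UNIV \<phi>"
    and irr: "irregular_set f \<phi> \<noteq> {}"
  shows "carries_full_mdim f (irregular_set f \<phi>)"
proof -
  let ?Z = "irregular_set f \<phi>"
  let ?S = "\<lambda>\<epsilon> n. ereal (1 / real n * ln (real (max_separated f n \<epsilon>)))"
  let ?T = "\<lambda>\<epsilon> n. ereal (1 / real n * ln (separated_sum f (\<lambda>x. 0) n \<epsilon>))"
  define lo up h where "lo \<epsilon> = liminf (?S \<epsilon>)" and "up \<epsilon> = limsup (?S \<epsilon>)"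
    and "h \<epsilon> = entropy_at f ?Z \<epsilon>" for \<epsilon>
  have S0: "\<forall>\<^sub>F n in sequentially. ?S \<epsilon> n = ?T \<epsilon> n" if "0 < \<epsilon>" for \<epsilon>
    using eventually_gt_at_top[of 0]
    by eventually_elim (use that separated_sum_zero_eq[OF X f] in simp)
  have lo: "lo \<epsilon> = liminf (?T \<epsilon>)" and up: "up \<epsilon> = limsup (?T \<epsilon>)" if "0 < \<epsilon>" for \<epsilon>
    unfolding lo_def up_def using S0[OF that] by (auto intro: Liminf_eq Limsup_eq)
  have lo_up: "lo \<epsilon> \<le> up \<epsilon>" for \<epsilon> unfolding lo_def up_def by (rule Liminf_le_Limsup) simp
  have lo_nonneg: "0 \<le> lo \<epsilon>" if "0 < \<epsilon>" for \<epsilon>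
    unfolding lo[OF that]
  proof (rule Liminf_bounded, rule eventually_mono[OF eventually_gt_at_top[of 0]])
    fix n :: nat assume "0 < n"
    then have "1 \<le> separated_sum f (\<lambda>x. 0) n \<epsilon>"
      using separated_sum_ge_exp[OF X f, of "\<lambda>x. 0" 0 n \<epsilon>] that by simp
    then show "0 \<le> ?T \<epsilon> n" by simp
  qed
  have pos: "\<forall>\<^sub>F \<epsilon> in at_right 0. (0::real) < \<epsilon>" by (rule eventually_at_right_less)
  have h_lo: "h (2 * \<epsilon>) \<le> lo \<epsilon>" if "0 < \<epsilon>" for \<epsilon>
    using pressure_at_leI[OF X f, of "\<lambda>x. 0" 0 "2 * \<epsilon>" 0 \<epsilon> ?Z] that
    by (simp add: h_def entropy_at_def lo)
  have up_h: "\<forall>\<^sub>F \<epsilon> in at_right 0. up (4 * \<epsilon>) \<le> ereal (1 + \<delta>) * h \<epsilon>" if \<delta>: "0 < \<delta>" "\<delta> \<le> 1" for \<delta>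
  proof -
    obtain \<epsilon>0 where \<epsilon>0: "0 < \<epsilon>0" "\<And>\<epsilon> \<psi> B v t. 0 < \<epsilon> \<Longrightarrow> \<epsilon> \<le> \<epsilon>0 \<Longrightarrow> (\<And>x. \<bar>\<psi> x\<bar> \<le> B) \<Longrightarrow>
        (\<And>x y. dist x y \<le> \<epsilon> \<Longrightarrow> \<bar>\<psi> x - \<psi> y\<bar> \<le> v) \<Longrightarrow>
        ereal t < limsup (\<lambda>n. ereal (1 / real n * ln (separated_sum f \<psi> n (4 * \<epsilon>)))) \<Longrightarrow>
        ereal ((t - v - \<delta> * B) / (1 + \<delta>)) \<le> pressure_at f ?Z \<psi> \<epsilon>"
      using pressure_at_irregular_set_ge[OF X f glue \<phi> irr \<delta>] by blast
    have "\<forall>\<^sub>F \<epsilon> in at_right 0. \<epsilon> \<in> {0<..<\<epsilon>0}" using \<epsilon>0(1) by (rule eventually_at_right_real)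
    then show ?thesis
    proof eventually_elim
      case (elim \<epsilon>)
      show ?case
      proof (rule ccontr)
        assume "\<not> ?thesis"
        then have "ereal (1 + \<delta>) * h \<epsilon> < up (4 * \<epsilon>)" by (simp only: not_le)
        from ereal_dense2[OF this] obtain t
          where t: "ereal (1 + \<delta>) * h \<epsilon> < ereal t" "ereal t < up (4 * \<epsilon>)" by blast
        have "ereal (t / (1 + \<delta>)) \<le> h \<epsilon>"
          using \<epsilon>0(2)[of \<epsilon> "\<lambda>x. 0" 0 0 t] t(2) elim by (simp add: h_def entropy_at_def up)
        then have "ereal (1 + \<delta>) * ereal (t / (1 + \<delta>)) \<le> ereal (1 + \<delta>) * h \<epsilon>"
          using \<delta> by (intro ereal_mult_left_mono) auto
        with t(1) \<delta> show False by simp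
      qed
    qed
  qed
  have h_nonneg: "\<forall>\<^sub>F \<epsilon> in at_right 0. 0 \<le> h \<epsilon>"
    using up_h[of 1, simplified] pos
  proof eventually_elim
    case (elim \<epsilon>)
    have "0 \<le> up (4 * \<epsilon>)" using lo_nonneg[of "4 * \<epsilon>"] lo_up[of "4 * \<epsilon>"] elim(2) by simp
    then have "0 \<le> ereal 2 * h \<epsilon>" using elim(1) by (simp add: order_trans)
    then show ?case by (simp add: ereal_zero_le_0_iff)
  qed
  have h_lo': "\<forall>\<^sub>F \<epsilon> in at_right 0. h (2 * \<epsilon>) \<le> ereal (1 + \<delta>) * lo \<epsilon>" if \<delta>: "0 < \<delta>" for \<delta>
    using pos
  proof eventually_elim
    case (elim \<epsilon>)
    have "1 * lo \<epsilon> \<le> ereal (1 + \<delta>) * lo \<epsilon>"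
      using lo_nonneg[OF elim] \<delta> by (intro ereal_mult_right_mono) (auto simp: one_ereal_def)
    then show ?case using h_lo[OF elim] by simp
  qed
  have lo_nn: "\<forall>\<^sub>F \<epsilon> in at_right 0. 0 \<le> lo \<epsilon>" and up_nn: "\<forall>\<^sub>F \<epsilon> in at_right 0. 0 \<le> up \<epsilon>"
    using pos by (eventually_elim, use lo_nonneg lo_up order_trans in blast)+
  have mdims: "lower_rel_mdim f ?Z = Liminf (at_right 0) (\<lambda>\<epsilon>. h \<epsilon> / ereal (- ln \<epsilon>))"
    "upper_rel_mdim f ?Z = Limsup (at_right 0) (\<lambda>\<epsilon>. h \<epsilon> / ereal (- ln \<epsilon>))"
    "lower_mdim f = Liminf (at_right 0) (\<lambda>\<epsilon>. lo \<epsilon> / ereal (- ln \<epsilon>))"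
    "upper_mdim f = Limsup (at_right 0) (\<lambda>\<epsilon>. up \<epsilon> / ereal (- ln \<epsilon>))"
    by (simp_all only: lower_rel_mdim_def upper_rel_mdim_def lower_mdim_def upper_mdim_def
        h_def lo_def up_def)
  have lo_h: "\<forall>\<^sub>F \<epsilon> in at_right 0. lo (4 * \<epsilon>) \<le> ereal (1 + \<delta>) * h \<epsilon>" if "0 < \<delta>" "\<delta> \<le> 1" for \<delta>
    using up_h[OF that] by eventually_elim (use lo_up order_trans in blast)
  have h_up: "\<forall>\<^sub>F \<epsilon> in at_right 0. h (2 * \<epsilon>) \<le> ereal (1 + \<delta>) * up \<epsilon>" if "0 < \<delta>" for \<delta>
    using h_lo'[OF that]
  proof eventually_elim
    case (elim \<epsilon>)
    also have "ereal (1 + \<delta>) * lo \<epsilon> \<le> ereal (1 + \<delta>) * up \<epsilon>"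
      using that lo_up by (intro ereal_mult_left_mono) auto
    finally show ?case .
  qed
  have "lower_rel_mdim f ?Z \<le> lower_mdim f"
    unfolding mdims using h_lo' lo_nn by (intro limits_over_minus_ln_le(1)[of 2]) auto
  moreover have "lower_mdim f \<le> lower_rel_mdim f ?Z"
    unfolding mdims using lo_h h_nonneg by (intro limits_over_minus_ln_le(1)[of 4]) auto
  moreover have "upper_rel_mdim f ?Z \<le> upper_mdim f"
    unfolding mdims using h_up up_nn by (intro limits_over_minus_ln_le(2)[of 2]) auto
  moreover have "upper_mdim f \<le> upper_rel_mdim f ?Z"
    unfolding mdims using up_h h_nonneg by (intro limits_over_minus_ln_le(2)[of 4]) auto
  ultimately show ?thesis unfolding carries_full_mdim_def by (intro conjI antisym)
qed

theorem theorem5: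
  fixes f :: "'a::metric_space \<Rightarrow> 'a" and \<phi> :: "'a \<Rightarrow> real ^ 'd"
  assumes "compact (UNIV :: 'a set)"
    and "continuous_on UNIV f"
    and "gluing_orbit_property f"
    and "continuous_on UNIV \<phi>"
    and "irregular_set f \<phi> \<noteq> {}"
  shows "carries_full_pressure f (irregular_set f \<phi>) \<and> carries_full_mdim f (irregular_set f \<phi>)"
  using irregular_set_carries_full_pressure[OF assms] irregular_set_carries_full_mdim[OF assms] by blast

end
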